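(* Let $p>1$, $z=(z',z_N)\in\mathbf{R}^N_+$, and let $\delta_z$ be the Dirac measure at $z$. Then $$\lim_{\kappa\to\infty}(\log\kappa)\,T(\kappa\delta_z)=\frac{z_N^2}{4}.$$
   Context: Let $N\ge1$. Write $x=(x',x_N)$, $\mathbf{R}^N_+=\{x_N>0\}$, $D:=\overline{\mathbf{R}^N_+}$, identifying $\partial\mathbf{R}^N_+$ with $\mathbf{R}^{N-1}$. Let $\Gamma_N(x,t)=(4\pi t)^{-N/2}e^{-|x|^2/(4t)}$, $G(x,y,t):=\Gamma_N(x-y,t)+\Gamma_N(x-y_*,t)$, $y_*=(y',-y_N)$, $[S(t)\mu](x):=\int_DG(x,y,t)\,d\mu(y)$. A nonnegative continuous $u$ on $D\times(0,T)$ is a solution of the initial-boundary problem ($\partial_tu=\Delta u$ in $\mathbf{R}^N_+$, $\partial_\nu u=u^p$ on $\partial\mathbf{R}^N_+$, $u(\cdot,0)=\mu$) in $[0,T)$ if $u(x,t)=[S(t)\mu](x)+\int_0^t\int_{\mathbf{R}^{N-1}}G(x,(y',0),t-s)u(y',0,s)^p\,dy'\,ds$ on $D\times(0,T)$; it is minimal if it lies below every other solution in $[0,T)$. The life span $T(\mu)$ is the maximal existence time of the minimal solution ($T(\mu)=0$ if no solution exists for any $T>0$). *)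

theory Defs
  imports "HOL-Probability.Probability"
begin

text \<open>Points of R^N, N = n + 1, are pairs (x', x_N) with x' :: nat \<Rightarrow> real an
  extensional vector supported on {..<n} (so x' ranges over R^(N-1), including N = 1).\<close>

type_synonym pt = "(nat \<Rightarrow> real) \<times> real"

definition bmeas :: "nat \<Rightarrow> (nat \<Rightarrow> real) measure" where
  "bmeas n = PiM {..<n} (\<lambda>_. lborel)"

definition ptmeas :: "nat \<Rightarrow> pt measure" where
  "ptmeas n = bmeas n \<Otimes>\<^sub>M lborel"

definition Dom :: "nat \<Rightarrow> pt set" where
  "Dom n = space (bmeas n) \<times> {0..}"

definition sqdist :: "nat \<Rightarrow> pt \<Rightarrow> pt \<Rightarrow> real" where
  "sqdist n x y = (\<Sum>i<n. (fst x i - fst y i)^2) + (snd x - snd y)^2"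

definition heat :: "nat \<Rightarrow> pt \<Rightarrow> pt \<Rightarrow> real \<Rightarrow> real" where
  "heat n x y t = (4 * pi * t) powr (- (real n + 1) / 2) * exp (- sqdist n x y / (4 * t))"

definition refl_pt :: "pt \<Rightarrow> pt" where
  "refl_pt y = (fst y, - snd y)"

definition Gker :: "nat \<Rightarrow> pt \<Rightarrow> pt \<Rightarrow> real \<Rightarrow> real" where
  "Gker n x y t = heat n x y t + heat n x (refl_pt y) t"

definition is_solution :: "nat \<Rightarrow> real \<Rightarrow> pt measure \<Rightarrow> real \<Rightarrow> (pt \<Rightarrow> real \<Rightarrow> real) \<Rightarrow> bool" where
  "is_solution n p \<mu> T u \<longleftrightarrow>
     (\<forall>x\<in>Dom n. \<forall>t\<in>{0<..<T}. 0 \<le> u x t) \<and>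
     continuous_on (Dom n \<times> {0<..<T}) (\<lambda>(x, t). u x t) \<and>
     (\<forall>x\<in>Dom n. \<forall>t\<in>{0<..<T}.
        ennreal (u x t) =
          (\<integral>\<^sup>+ y. ennreal (Gker n x y t) * indicator (Dom n) y \<partial>\<mu>) +
          (\<integral>\<^sup>+ s. (\<integral>\<^sup>+ y'. ennreal (Gker n x (y', 0) (t - s) * u (y', 0) s powr p) \<partial>bmeas n)
                    * indicator {0<..<t} s \<partial>lborel))"

definition is_minimal_solution :: "nat \<Rightarrow> real \<Rightarrow> pt measure \<Rightarrow> real \<Rightarrow> (pt \<Rightarrow> real \<Rightarrow> real) \<Rightarrow> bool" where
  "is_minimal_solution n p \<mu> T u \<longleftrightarrow> is_solution n p \<mu> T u \<and>
     (\<forall>v. is_solution n p \<mu> T v \<longrightarrow> (\<forall>x\<in>Dom n. \<forall>t\<in>{0<..<T}. u x t \<le> v x t))"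

definition life_span :: "nat \<Rightarrow> real \<Rightarrow> pt measure \<Rightarrow> ereal" where
  "life_span n p \<mu> = Sup ({0} \<union> {ereal T | T. 0 < T \<and> (\<exists>u. is_minimal_solution n p \<mu> T u)})"

definition dirac_mass :: "nat \<Rightarrow> real \<Rightarrow> pt \<Rightarrow> pt measure" where
  "dirac_mass n \<kappa> z = scale_measure (ennreal \<kappa>) (return (ptmeas n) z)"

end

theory Submission
  imports Defs "HOL-Real_Asymp.Real_Asymp"
begin

text \<open>
  Write \<open>a = z\<^sub>N\<^sup>2 / 4\<close>. On the boundary the linear part of the solution with datum \<open>\<kappa> \<delta>\<^sub>z\<close> has size
  \<open>\<kappa> exp (- a / t)\<close> up to powers of \<open>t\<close>; at \<open>t = c / ln \<kappa>\<close> this is a power of \<open>\<kappa>\<close> whose exponent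
  \<open>1 - a / c\<close> changes sign at \<open>c = a\<close>.
  For \<open>c < a\<close> the boundary data stay below \<open>1/2\<close> and the time is short, so the Picard iterates
  stay below \<open>1\<close> on the boundary and increase to the minimal solution.
  For \<open>c > a\<close> the boundary data reach \<open>\<kappa> powr d\<close> with \<open>d > 0\<close> on a fixed cube around \<open>z'\<close>
  during a time of order \<open>1 / ln \<kappa>\<close>, which is more than the nonlinear boundary flux needs to blow up.
\<close>

section \<open>The heat kernel of the half-space\<close>

lemma space_bmeas: "space (bmeas n) = (\<Pi>\<^sub>E i\<in>{..<n}. UNIV)"
  by (simp add: bmeas_def space_PiM)

lemma sigma_finite_bmeas: "sigma_finite_measure (bmeas n)"
proof -
  interpret product_sigma_finite "\<lambda>_::nat. lborel :: real measure" ..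
  show ?thesis unfolding bmeas_def by (rule sigma_finite) simp
qed

lemma pair_sigma_finite_bmeas: "pair_sigma_finite (bmeas n) (lborel :: real measure)"
  by (intro pair_sigma_finite.intro sigma_finite_bmeas sigma_finite_lborel)

lemma measurable_bmeas_component: "i < n \<Longrightarrow> (\<lambda>y. y i) \<in> borel_measurable (bmeas n)"
  unfolding bmeas_def by measurable

lemma measurable_heat:
  assumes [measurable]: "a \<in> M \<rightarrow>\<^sub>M ptmeas n" "b \<in> M \<rightarrow>\<^sub>M ptmeas n" "\<tau> \<in> borel_measurable M"
  shows "(\<lambda>\<omega>. heat n (a \<omega>) (b \<omega>) (\<tau> \<omega>)) \<in> borel_measurable M"
proof -
  have fst: "(\<lambda>\<omega>. fst (c \<omega>) i) \<in> borel_measurable M" if "c \<in> M \<rightarrow>\<^sub>M ptmeas n" "i < n" for c :: "'a \<Rightarrow> pt" and i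
    using that by (intro measurable_compose[OF _ measurable_bmeas_component]
        measurable_compose[OF _ measurable_fst]) (auto simp: ptmeas_def)
  have snd: "(\<lambda>\<omega>. snd (c \<omega>)) \<in> borel_measurable M" if "c \<in> M \<rightarrow>\<^sub>M ptmeas n" for c :: "'a \<Rightarrow> pt"
    using that measurable_compose[OF _ measurable_snd, of c M "bmeas n" lborel] by (auto simp: ptmeas_def)
  have [measurable]: "(\<lambda>\<omega>. sqdist n (a \<omega>) (b \<omega>)) \<in> borel_measurable M"
    unfolding sqdist_def
    by (intro borel_measurable_add borel_measurable_sum borel_measurable_power borel_measurable_diff fst snd)
       (auto simp: assms)
  show ?thesis unfolding heat_def by measurable
qed

lemma measurable_refl_pt: "refl_pt \<in> ptmeas n \<rightarrow>\<^sub>M ptmeas n"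
  unfolding refl_pt_def[abs_def] ptmeas_def by measurable

lemma measurable_Gker:
  assumes [measurable]: "a \<in> M \<rightarrow>\<^sub>M ptmeas n" "b \<in> M \<rightarrow>\<^sub>M ptmeas n" "\<tau> \<in> borel_measurable M"
  shows "(\<lambda>\<omega>. Gker n (a \<omega>) (b \<omega>) (\<tau> \<omega>)) \<in> borel_measurable M"
  unfolding Gker_def
  by (intro borel_measurable_add measurable_heat measurable_compose[OF _ measurable_refl_pt] assms)

lemma ptmeas_in_space: "x \<in> Dom n \<Longrightarrow> x \<in> space (ptmeas n)"
  by (auto simp: Dom_def ptmeas_def space_pair_measure)

lemma heat_nonneg: "0 \<le> heat n x y t"
  by (simp add: heat_def)

lemma Gker_nonneg: "0 \<le> Gker n x y t"
  by (simp add: Gker_def heat_nonneg)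

lemma Gker_boundary: "Gker n x (y, 0) t = 2 * heat n x (y, 0) t"
  by (simp add: Gker_def refl_pt_def)

lemma Gker_boundary_left: "Gker n (y, 0) x t = 2 * heat n (y, 0) x t"
  by (simp add: Gker_def heat_def sqdist_def refl_pt_def)

text \<open>The Gaussian factors into one-dimensional normal densities in the tangential coordinates
  and one factor in the normal coordinate. Each density integrates to 1, so only the normal factor
  survives.\<close>

lemma nn_integral_heat:
  assumes "t > 0"
  shows "(\<integral>\<^sup>+y. ennreal (heat n x (y, b) t) \<partial>bmeas n) =
    ennreal ((4 * pi * t) powr (-1/2) * exp (- (snd x - b)\<^sup>2 / (4 * t)))"
proof -
  interpret product_sigma_finite "\<lambda>_::nat. lborel :: real measure" ..
  define c where "c = (4 * pi * t) powr (-1/2) * exp (- (snd x - b)\<^sup>2 / (4 * t))"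
  have "c \<ge> 0" by (simp add: c_def)
  have pos: "4 * pi * t > 0" using assms by simp
  \<comment> \<open>The exponent \<open>(y - \<mu>)^2 / (4 * t)\<close> corresponds to variance
    \<open>2 * t\<close>, hence to the standard deviation \<open>sqrt (2 * t)\<close>.\<close>
  have nd: "normal_density \<mu> (sqrt (2 * t)) y = (4 * pi * t) powr (-1/2) * exp (- (\<mu> - y)\<^sup>2 / (4 * t))" for \<mu> y
    using assms pos by (simp add: normal_density_def powr_minus powr_half_sqrt divide_simps power2_commute)
  have "heat n x (y, b) t = c * (\<Prod>i<n. normal_density (fst x i) (sqrt (2 * t)) (y i))" for y
  proof -
    have "(\<Prod>i<n. normal_density (fst x i) (sqrt (2 * t)) (y i))
       = ((4 * pi * t) powr (-1/2)) ^ n * exp (\<Sum>i<n. - (fst x i - y i)\<^sup>2 / (4 * t))"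
      by (simp add: nd prod.distrib exp_sum)
    moreover have "((4 * pi * t) powr (-1/2)) ^ n * (4 * pi * t) powr (-1/2) = (4 * pi * t) powr (- (real n + 1) / 2)"
    proof -
      have 1: "((4 * pi * t) powr (-1/2)) ^ n = (4 * pi * t) powr (real n * (-1/2))"
        using pos by (intro powr_power) auto
      show ?thesis
        unfolding 1 by (subst powr_add[symmetric], rule arg_cong[where f = "\<lambda>e. (4 * pi * t) powr e"]) (simp add: field_simps)
    qed
    moreover have "exp (- sqdist n x (y, b) / (4 * t)) =
        exp (\<Sum>i<n. - (fst x i - y i)\<^sup>2 / (4 * t)) * exp (- (snd x - b)\<^sup>2 / (4 * t))"
      by (simp add: exp_add[symmetric] sqdist_def sum_divide_distrib sum_negf add_divide_distrib diff_divide_distrib)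
    ultimately show ?thesis unfolding heat_def c_def by (simp add: mult_ac)
  qed
  then have "(\<integral>\<^sup>+y. ennreal (heat n x (y, b) t) \<partial>bmeas n) =
     (\<integral>\<^sup>+y. ennreal c * (\<Prod>i<n. ennreal (normal_density (fst x i) (sqrt (2 * t)) (y i))) \<partial>bmeas n)"
    using \<open>c \<ge> 0\<close> by (simp add: ennreal_mult prod_nonneg prod_ennreal)
  also have "\<dots> = ennreal c * (\<integral>\<^sup>+y. (\<Prod>i<n. ennreal (normal_density (fst x i) (sqrt (2 * t)) (y i))) \<partial>bmeas n)"
    unfolding bmeas_def by (intro nn_integral_cmult) measurable
  also have "(\<integral>\<^sup>+y. (\<Prod>i<n. ennreal (normal_density (fst x i) (sqrt (2 * t)) (y i))) \<partial>bmeas n)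
     = (\<Prod>i<n. \<integral>\<^sup>+y. ennreal (normal_density (fst x i) (sqrt (2 * t)) y) \<partial>lborel)"
    unfolding bmeas_def by (rule product_nn_integral_prod) auto
  also have "\<dots> = 1"
    using assms by (simp add: nn_integral_eq_integral)
  finally show ?thesis by (simp add: c_def)
qed

lemma nn_integral_Gker:
  assumes "t > 0"
  shows "(\<integral>\<^sup>+y. ennreal (Gker n x (y, 0) t) \<partial>bmeas n) =
    ennreal (2 * (4 * pi * t) powr (-1/2) * exp (- (snd x)\<^sup>2 / (4 * t)))"
proof -
  have 1: "(\<lambda>y. heat n x (y, 0) t) \<in> borel_measurable (bmeas n)"
    unfolding heat_def sqdist_def bmeas_def by simp
  show ?thesis
    unfolding Gker_boundary
    using nn_integral_heat[OF assms, of n x 0] 1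
    by (simp add: ennreal_mult heat_nonneg nn_integral_cmult)
       (simp add: ennreal_mult[symmetric] mult_ac flip: ennreal_numeral)
qed

text \<open>The total kernel mass on the boundary is singular only like the power -1/2 of the
  elapsed time. Its integrability is the source of every factor \<open>2 * sqrt t\<close>
  below.\<close>

lemma nn_integral_powr_minus_half:
  assumes "t \<ge> 0"
  shows "(\<integral>\<^sup>+s. ennreal (s powr (-1/2)) * indicator {0<..<t} s \<partial>lborel) = ennreal (2 * sqrt t)"
proof -
  have "((\<lambda>x. x powr (-1/2)) has_integral (t powr (-1/2+1) / (-1/2+1))) {0..t}"
    by (rule has_integral_powr_from_0) (use assms in auto)
  moreover have "t powr (-1/2+1) / (-1/2+1) = 2 * sqrt t"
    using assms by (simp add: powr_half_sqrt)
  ultimately have "((\<lambda>x. if x \<in> {0..t} then x powr (-1/2) else 0) has_integral (2 * sqrt t)) UNIV"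
    by (simp only: has_integral_restrict_UNIV)
  then have "(\<integral>\<^sup>+s. ennreal (if s \<in> {0..t} then s powr (-1/2) else 0) \<partial>lborel) = ennreal (2 * sqrt t)"
    by (intro nn_integral_has_integral_lborel) auto
  \<comment> \<open>Since \<open>0 powr (-1/2) = 0\<close>, the closed and the open interval give
    integrands that differ only at the endpoint \<open>t\<close>.\<close>
  moreover have "(\<integral>\<^sup>+s. ennreal (if s \<in> {0..t} then s powr (-1/2) else 0) \<partial>lborel)
     = (\<integral>\<^sup>+s. ennreal (s powr (-1/2)) * indicator {0<..<t} s \<partial>lborel)"
    by (intro nn_integral_cong_AE eventually_mono[OF AE_lborel_singleton[of t]])
       (auto simp: indicator_def)
  ultimately show ?thesis by simp
qed

section \<open>The boundary potential\<close>

text \<open>The nonlinear term of the integral equation with a general density \<open>f\<close> in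
  place of \<open>u powr p\<close>. Values in \<open>ennreal\<close> keep divergent potentials
  meaningful, and negative values of the integrand are cut to 0, so monotonicity in \<open>f\<close>
  needs no sign condition.\<close>

definition bpot :: "nat \<Rightarrow> ((nat \<Rightarrow> real) \<Rightarrow> real \<Rightarrow> real) \<Rightarrow> pt \<Rightarrow> real \<Rightarrow> ennreal" where
  "bpot n f x t = (\<integral>\<^sup>+s. (\<integral>\<^sup>+y. ennreal (Gker n x (y, 0) (t - s) * f y s) \<partial>bmeas n) * indicator {0<..<t} s \<partial>lborel)"

text \<open>The mass that the kernel puts on the whole boundary after time \<open>s\<close>, seen
  from height \<open>b\<close>, cut off to times in \<open>{0<..<t}\<close>. With the tangential
  variable integrated out, questions about the constant density 1 become one-dimensional.\<close>

definition bmass :: "real \<Rightarrow> real \<Rightarrow> real \<Rightarrow> real" where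
  "bmass b t s = 2 * (4 * pi * s) powr (-1/2) * exp (- b\<^sup>2 / (4 * s)) * indicator {0<..<t} s"

lemma ptmeas_pair_boundary: "(\<lambda>\<omega>. (fst \<omega>, 0)) \<in> bmeas n \<Otimes>\<^sub>M (lborel::real measure) \<rightarrow>\<^sub>M ptmeas n"
  unfolding ptmeas_def by measurable

lemma measurable_Gker_boundary:
  assumes "x \<in> Dom n"
  shows "(\<lambda>\<omega>. Gker n x (fst \<omega>, 0) (t - snd \<omega>)) \<in> borel_measurable (bmeas n \<Otimes>\<^sub>M lborel)"
proof (rule measurable_Gker)
  show "(\<lambda>\<omega>. x) \<in> bmeas n \<Otimes>\<^sub>M lborel \<rightarrow>\<^sub>M ptmeas n"
    using ptmeas_in_space[OF assms] by simp
  show "(\<lambda>\<omega>. t - snd \<omega>) \<in> borel_measurable (bmeas n \<Otimes>\<^sub>M lborel)"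
    by measurable
qed (rule ptmeas_pair_boundary)

lemma bpot_mono:
  assumes "\<And>y s. y \<in> space (bmeas n) \<Longrightarrow> 0 < s \<Longrightarrow> s < t \<Longrightarrow> f y s \<le> g y s"
  shows "bpot n f x t \<le> bpot n g x t"
  unfolding bpot_def
  using assms
  by (intro nn_integral_mono) (auto simp: indicator_def intro!: nn_integral_mono ennreal_leI mult_left_mono Gker_nonneg)

lemma bpot_cong:
  assumes "\<And>y s. y \<in> space (bmeas n) \<Longrightarrow> 0 < s \<Longrightarrow> s < t \<Longrightarrow> f y s = g y s"
  shows "bpot n f x t = bpot n g x t"
  using assms by (intro antisym bpot_mono) auto

text \<open>Tonelli's theorem gives one integral over a fixed measure space, with the time cutoff
  inside the integrand. The convergence theorems apply in this form.\<close>

lemma bpot_pair: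
  assumes x: "x \<in> Dom n" and f[measurable]: "(\<lambda>\<omega>. f (fst \<omega>) (snd \<omega>)) \<in> borel_measurable (bmeas n \<Otimes>\<^sub>M lborel)"
  shows "bpot n f x t = (\<integral>\<^sup>+\<omega>. ennreal (Gker n x (fst \<omega>, 0) (t - snd \<omega>) * indicator {0<..<t} (snd \<omega>) * f (fst \<omega>) (snd \<omega>))
     \<partial>(bmeas n \<Otimes>\<^sub>M lborel))"
proof -
  interpret pair_sigma_finite "bmeas n" "lborel :: real measure" by (rule pair_sigma_finite_bmeas)
  note [measurable] = measurable_Gker_boundary[OF x]
  show ?thesis
    by (subst nn_integral_snd[symmetric])
       (auto simp: bpot_def intro!: nn_integral_cong split: split_indicator)
qed

text \<open>Reversing time by \<open>s\<close> to \<open>t - s\<close> moves the singularity to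
  \<open>s = 0\<close> for every \<open>t\<close>, so a single dominating function can serve all
  times.\<close>

lemma bpot_one:
  "bpot n (\<lambda>_ _. 1) x t = (\<integral>\<^sup>+s. ennreal (bmass (snd x) t s) \<partial>lborel)"
proof -
  have "bpot n (\<lambda>_ _. 1) x t = (\<integral>\<^sup>+s. ennreal (bmass (snd x) t (t - s)) \<partial>lborel)"
    unfolding bpot_def
  proof (intro nn_integral_cong)
    fix s
    show "(\<integral>\<^sup>+y. ennreal (Gker n x (y, 0) (t - s) * 1) \<partial>bmeas n) * indicator {0<..<t} s = ennreal (bmass (snd x) t (t - s))"
      using nn_integral_Gker[of "t - s" n x]
      by (auto simp: bmass_def split: split_indicator)
  qed
  also have "\<dots> = (\<integral>\<^sup>+s. ennreal (bmass (snd x) t s) \<partial>lborel)"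
    by (subst (2) nn_integral_real_affine[where c = "-1" and t = t]) (auto simp: bmass_def)
  finally show ?thesis .
qed

text \<open>The prefactor equals \<open>1 / sqrt (pi * s)\<close> and the exponential is at most 1.
  The bound does not depend on the height \<open>b\<close>.\<close>

lemma bmass_le: "bmass b t s \<le> s powr (-1/2) * indicator {0<..<t} s"
proof (cases "0 < s \<and> s < t")
  case True
  have "2 * (4 * pi * s) powr (-1/2) = pi powr (-1/2) * s powr (-1/2)"
    using True by (simp add: powr_mult powr_minus powr_half_sqrt divide_simps)
  also have "\<dots> \<le> 1 * s powr (-1/2)"
    using pi_ge_two by (intro mult_right_mono) (auto simp: powr_minus powr_half_sqrt divide_simps)
  finally have 1: "2 * (4 * pi * s) powr (-1/2) \<le> s powr (-1/2)" by simp
  have "2 * (4 * pi * s) powr (-1/2) * exp (- b\<^sup>2 / (4 * s)) \<le> s powr (-1/2) * 1"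
    by (intro mult_mono 1) (use True in auto)
  then show ?thesis using True by (simp add: bmass_def)
qed (auto simp: bmass_def)

lemma bpot_one_le: "t \<ge> 0 \<Longrightarrow> bpot n (\<lambda>_ _. 1) x t \<le> ennreal (2 * sqrt t)"
proof -
  assume t: "t \<ge> 0"
  have "bpot n (\<lambda>_ _. 1) x t \<le> (\<integral>\<^sup>+s. ennreal (s powr (-1/2)) * indicator {0<..<t} s \<partial>lborel)"
    unfolding bpot_one using bmass_le[of "snd x" t]
    by (intro nn_integral_mono) (simp add: ennreal_leI ennreal_indicator[symmetric] ennreal_mult[symmetric])
  then show ?thesis using nn_integral_powr_minus_half[OF t] by simp
qed

lemma bpot_le:
  assumes "\<And>y s. y \<in> space (bmeas n) \<Longrightarrow> 0 < s \<Longrightarrow> s < t \<Longrightarrow> f y s \<le> 1" "t \<ge> 0"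
  shows "bpot n f x t \<le> ennreal (2 * sqrt t)"
  using bpot_mono[of n t f "\<lambda>_ _. 1" x] bpot_one_le[of t n x] assms by (meson order_trans)

text \<open>Dominated convergence after time reversal. This supplies the convergence of masses that
  Scheffe's lemma asks for.\<close>

lemma bpot_one_tendsto:
  assumes b: "(\<lambda>k. snd (X k)) \<longlonglongrightarrow> snd x" and \<tau>: "\<tau> \<longlonglongrightarrow> t" and T: "\<And>k. \<tau> k < T"
  shows "(\<lambda>k. bpot n (\<lambda>_ _. 1) (X k) (\<tau> k)) \<longlonglongrightarrow> bpot n (\<lambda>_ _. 1) x t"
  unfolding bpot_one
proof (rule nn_integral_dominated_convergence[where w = "\<lambda>s. ennreal (s powr (-1/2)) * indicator {0<..<T} s"])
  show "AE s in lborel. ennreal (bmass (snd (X j)) (\<tau> j) s) \<le> ennreal (s powr (-1/2)) * indicator {0<..<T} s" for j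
  proof (intro AE_I2)
    fix s
    have "bmass (snd (X j)) (\<tau> j) s \<le> s powr (-1/2) * indicator {0<..<T} s"
      using T[of j] by (intro order_trans[OF bmass_le]) (auto simp: indicator_def)
    then show "ennreal (bmass (snd (X j)) (\<tau> j) s) \<le> ennreal (s powr (-1/2)) * indicator {0<..<T} s"
      by (simp add: ennreal_leI ennreal_indicator[symmetric] ennreal_mult[symmetric])
  qed
  show "(\<integral>\<^sup>+s. ennreal (s powr (-1/2)) * indicator {0<..<T} s \<partial>lborel) < \<infinity>"
  proof (cases "T \<ge> 0")
    case True
    then show ?thesis by (subst nn_integral_powr_minus_half) auto
  qed auto
  \<comment> \<open>At \<open>s = t\<close> the cutoff \<open>{0<..<\<tau> k}\<close> may oscillate
    with \<open>k\<close>; this single point is a null set. At \<open>s = 0\<close> the cutoff makes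
    everything vanish.\<close>
  show "AE s in lborel. (\<lambda>k. ennreal (bmass (snd (X k)) (\<tau> k) s)) \<longlonglongrightarrow> ennreal (bmass (snd x) t s)"
  proof (rule eventually_mono[OF AE_lborel_singleton[of t]], rule tendsto_ennrealI)
    fix s assume "s \<noteq> t"
    have ind: "(\<lambda>k. indicator {0<..<\<tau> k} s :: real) \<longlonglongrightarrow> indicator {0<..<t} s"
    proof (rule tendsto_eventually, cases "s < t")
      case True
      show "\<forall>\<^sub>F k in sequentially. indicator {0<..<\<tau> k} s = (indicator {0<..<t} s :: real)"
        using order_tendstoD(1)[OF \<tau> True] by eventually_elim (use True in \<open>auto simp: indicator_def\<close>)
    next
      case False
      then show "\<forall>\<^sub>F k in sequentially. indicator {0<..<\<tau> k} s = (indicator {0<..<t} s :: real)"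
        using order_tendstoD(2)[OF \<tau>, of s] \<open>s \<noteq> t\<close> by (auto elim!: eventually_mono simp: indicator_def)
    qed
    show "(\<lambda>k. bmass (snd (X k)) (\<tau> k) s) \<longlonglongrightarrow> bmass (snd x) t s"
      unfolding bmass_def by (cases "s = 0") (auto intro!: tendsto_intros b ind)
  qed
qed (auto simp: bmass_def)

lemma heat_tendsto:
  assumes "\<And>i. i < n \<Longrightarrow> (\<lambda>k. fst (X k) i) \<longlonglongrightarrow> fst x i" "(\<lambda>k. snd (X k)) \<longlonglongrightarrow> snd x"
    "\<tau> \<longlonglongrightarrow> t" "t > 0"
  shows "(\<lambda>k. heat n (X k) y (\<tau> k)) \<longlonglongrightarrow> heat n x y t"
  unfolding heat_def sqdist_def using assms(4)
  by (intro tendsto_intros assms) auto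

lemma Gker_tendsto:
  assumes "\<And>i. i < n \<Longrightarrow> (\<lambda>k. fst (X k) i) \<longlonglongrightarrow> fst x i" "(\<lambda>k. snd (X k)) \<longlonglongrightarrow> snd x"
    "\<tau> \<longlonglongrightarrow> t" "t > 0"
  shows "(\<lambda>k. Gker n (X k) y (\<tau> k)) \<longlonglongrightarrow> Gker n x y t"
  unfolding Gker_def by (intro tendsto_add heat_tendsto assms)

lemma AE_bmeas_lborel_snd_neq: "AE \<omega> in bmeas n \<Otimes>\<^sub>M (lborel :: real measure). snd \<omega> \<noteq> t"
proof (rule AE_I[where N = "space (bmeas n) \<times> {t}"])
  show "emeasure (bmeas n \<Otimes>\<^sub>M lborel) (space (bmeas n) \<times> {t}) = 0"
    by (simp add: lborel.emeasure_pair_measure_Times)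
qed (auto simp: space_pair_measure)

text \<open>The kernels converge almost everywhere and their masses converge, so they converge in mean
  by Scheffe's lemma; this makes the potential of a bounded density continuous.\<close>

lemma bpot_tendsto:
  assumes f[measurable]: "(\<lambda>\<omega>. f (fst \<omega>) (snd \<omega>)) \<in> borel_measurable (bmeas n \<Otimes>\<^sub>M lborel)"
    and f01: "\<And>y s. y \<in> space (bmeas n) \<Longrightarrow> 0 < s \<Longrightarrow> s < T \<Longrightarrow> 0 \<le> f y s \<and> f y s \<le> 1"
    and X: "\<And>k. X k \<in> Dom n" "x \<in> Dom n"
    and Xlim: "\<And>i. i < n \<Longrightarrow> (\<lambda>k. fst (X k) i) \<longlonglongrightarrow> fst x i" "(\<lambda>k. snd (X k)) \<longlonglongrightarrow> snd x"
    and \<tau>: "\<tau> \<longlonglongrightarrow> t" "\<And>k. 0 < \<tau> k \<and> \<tau> k < T" "0 < t" "t < T"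
  shows "(\<lambda>k. enn2real (bpot n f (X k) (\<tau> k))) \<longlonglongrightarrow> enn2real (bpot n f x t)"
proof -
  let ?M = "bmeas n \<Otimes>\<^sub>M (lborel :: real measure)"
  define K where "K y r \<omega> = Gker n y (fst \<omega>, 0) (r - snd \<omega>) * indicator {0<..<r} (snd \<omega>)" for y r and \<omega> :: "(nat \<Rightarrow> real) \<times> real"
  \<comment> \<open>Nothing is known about \<open>f\<close> outside the times in
    \<open>{0<..<T}\<close>. Replacing it by 0 there gives a density bounded everywhere and leaves
    the potential unchanged, because \<open>K y r\<close> vanishes unless
    \<open>0 < s < r\<close>.\<close>
  define g where "g \<omega> = (if 0 < snd \<omega> \<and> snd \<omega> < T then f (fst \<omega>) (snd \<omega>) else 0)" for \<omega>
  have [measurable]: "K y r \<in> borel_measurable ?M" if "y \<in> Dom n" for y r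
    unfolding K_def[abs_def] using measurable_Gker_boundary[OF that, of r] by measurable
  have [measurable]: "g \<in> borel_measurable ?M"
    unfolding g_def[abs_def] by measurable
  have K0: "0 \<le> K y r \<omega>" for y r \<omega>
    by (simp add: K_def Gker_nonneg)
  have g01: "0 \<le> g \<omega>" "g \<omega> \<le> 1" if "\<omega> \<in> space ?M" for \<omega>
    using that f01[of "fst \<omega>" "snd \<omega>"] by (auto simp: g_def space_pair_measure)
  have one: "bpot n (\<lambda>_ _. 1) y r = (\<integral>\<^sup>+\<omega>. ennreal (K y r \<omega>) \<partial>?M)" if "y \<in> Dom n" for y r
    using bpot_pair[OF that, of "\<lambda>_ _. 1" r] by (simp add: K_def)
  have Kint: "integrable ?M (K y r)" if "y \<in> Dom n" "r \<ge> 0" for y r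
  proof (rule integrableI_nonneg)
    show "(\<integral>\<^sup>+\<omega>. ennreal (K y r \<omega>) \<partial>?M) < \<infinity>"
      using bpot_one_le[OF that(2), of n y] one[OF that(1), of r] by (simp add: order.strict_trans1)
  qed (use that K0 in auto)
  have pot: "enn2real (bpot n f y r) = (\<integral>\<omega>. K y r \<omega> * g \<omega> \<partial>?M)" if "y \<in> Dom n" "r < T" for y r
  proof -
    have "bpot n f y r = (\<integral>\<^sup>+\<omega>. ennreal (K y r \<omega> * g \<omega>) \<partial>?M)"
      unfolding bpot_pair[OF that(1) f]
      by (intro nn_integral_cong) (use that in \<open>auto simp: K_def g_def split: split_indicator\<close>)
    then show ?thesis
      using that(1) by (subst integral_eq_nn_integral) (auto intro!: AE_I2 mult_nonneg_nonneg K0 g01)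
  qed
  have Kgint: "integrable ?M (\<lambda>\<omega>. K y r \<omega> * g \<omega>)" if "y \<in> Dom n" "r \<ge> 0" for y r
    by (rule Bochner_Integration.integrable_bound[OF Kint[OF that]])
       (use that(1) g01 in \<open>auto intro!: AE_I2 simp: abs_mult K0 intro: mult_left_le\<close>)
  have lim1: "(\<lambda>k. \<integral>\<^sup>+\<omega>. norm (K (X k) (\<tau> k) \<omega> - K x t \<omega>) \<partial>?M) \<longlonglongrightarrow> 0"
  proof (rule Scheffe_lemma1)
    show "AE \<omega> in ?M. (\<lambda>k. K (X k) (\<tau> k) \<omega>) \<longlonglongrightarrow> K x t \<omega>"
    proof (rule eventually_mono[OF AE_bmeas_lborel_snd_neq[of t n]])
      fix \<omega> :: "(nat \<Rightarrow> real) \<times> real" assume neq: "snd \<omega> \<noteq> t"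
      show "(\<lambda>k. K (X k) (\<tau> k) \<omega>) \<longlonglongrightarrow> K x t \<omega>"
      proof (cases "snd \<omega> < t")
        case True
        have "\<forall>\<^sub>F k in sequentially. indicator {0<..<\<tau> k} (snd \<omega>) = (indicator {0<..<t} (snd \<omega>) :: real)"
          using order_tendstoD(1)[OF \<tau>(1) True] by eventually_elim (use True in \<open>auto simp: indicator_def\<close>)
        then show ?thesis unfolding K_def
          by (intro tendsto_mult Gker_tendsto Xlim tendsto_diff \<tau> tendsto_const tendsto_eventually)
             (use True in auto)
      next
        case False
        then have "\<forall>\<^sub>F k in sequentially. K (X k) (\<tau> k) \<omega> = K x t \<omega>"
          using order_tendstoD(2)[OF \<tau>(1), of "snd \<omega>"] neq
          by (auto elim!: eventually_mono simp: K_def indicator_def)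
        then show ?thesis by (rule tendsto_eventually)
      qed
    qed
    \<comment> \<open>The L1 norm of \<open>K y r\<close> is the potential of the constant density
      1.\<close>
    have "(\<lambda>k. \<integral>\<^sup>+\<omega>. norm (K (X k) (\<tau> k) \<omega>) \<partial>?M) \<longlonglongrightarrow> (\<integral>\<^sup>+\<omega>. norm (K x t \<omega>) \<partial>?M)"
      using bpot_one_tendsto[OF Xlim(2) \<tau>(1), of T n] \<tau>(2) X by (simp add: one K0)
    then show "limsup (\<lambda>k. \<integral>\<^sup>+\<omega>. norm (K (X k) (\<tau> k) \<omega>) \<partial>?M) \<le> (\<integral>\<^sup>+\<omega>. norm (K x t \<omega>) \<partial>?M)"
      by (simp add: lim_imp_Limsup)
  qed (use X \<tau> in \<open>auto intro!: Kint less_imp_le\<close>)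
  show ?thesis
  proof (rule Lim_null[THEN iffD2], rule tendsto_norm_zero_cancel, rule real_tendsto_sandwich[where f = "\<lambda>_. 0"])
    show "\<forall>\<^sub>F k in sequentially. norm (enn2real (bpot n f (X k) (\<tau> k)) - enn2real (bpot n f x t))
        \<le> enn2real (\<integral>\<^sup>+\<omega>. norm (K (X k) (\<tau> k) \<omega> - K x t \<omega>) \<partial>?M)"
    proof (intro always_eventually allI)
      fix k
      note i1 = Kint[OF X(1)[of k], of "\<tau> k"] Kint[OF X(2), of t]
      note i2 = Kgint[OF X(1)[of k], of "\<tau> k"] Kgint[OF X(2), of t]
      have r: "0 \<le> \<tau> k" "\<tau> k < T" using \<tau>(2)[of k] by auto
      have "enn2real (bpot n f (X k) (\<tau> k)) - enn2real (bpot n f x t) = (\<integral>\<omega>. (K (X k) (\<tau> k) \<omega> - K x t \<omega>) * g \<omega> \<partial>?M)"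
        using i2 r \<tau>(3,4) by (simp add: pot X left_diff_distrib Bochner_Integration.integral_diff)
      also have "norm \<dots> \<le> (\<integral>\<omega>. norm ((K (X k) (\<tau> k) \<omega> - K x t \<omega>) * g \<omega>) \<partial>?M)"
        by (rule integral_norm_bound)
      also have "\<dots> \<le> (\<integral>\<omega>. norm (K (X k) (\<tau> k) \<omega> - K x t \<omega>) \<partial>?M)"
      proof (rule integral_mono)
        have "integrable ?M (\<lambda>\<omega>. (K (X k) (\<tau> k) \<omega> - K x t \<omega>) * g \<omega>)"
          using Bochner_Integration.integrable_diff[OF i2] r \<tau>(3) by (simp add: left_diff_distrib)
        then show "integrable ?M (\<lambda>\<omega>. norm ((K (X k) (\<tau> k) \<omega> - K x t \<omega>) * g \<omega>))"
          by (rule integrable_norm)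
        show "integrable ?M (\<lambda>\<omega>. norm (K (X k) (\<tau> k) \<omega> - K x t \<omega>))"
          using i1 r \<tau>(3) by (intro integrable_norm Bochner_Integration.integrable_diff) auto
      qed (use g01 in \<open>auto simp: abs_mult intro!: mult_left_le\<close>)
      also have "\<dots> = enn2real (\<integral>\<^sup>+\<omega>. norm (K (X k) (\<tau> k) \<omega> - K x t \<omega>) \<partial>?M)"
        using X by (intro integral_eq_nn_integral) auto
      finally show "norm (enn2real (bpot n f (X k) (\<tau> k)) - enn2real (bpot n f x t))
        \<le> enn2real (\<integral>\<^sup>+\<omega>. norm (K (X k) (\<tau> k) \<omega> - K x t \<omega>) \<partial>?M)" .
    qed
    show "(\<lambda>k. enn2real (\<integral>\<^sup>+\<omega>. norm (K (X k) (\<tau> k) \<omega> - K x t \<omega>) \<partial>?M)) \<longlonglongrightarrow> 0"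
      using tendsto_enn2real[of "\<lambda>k. \<integral>\<^sup>+\<omega>. norm (K (X k) (\<tau> k) \<omega> - K x t \<omega>) \<partial>?M" 0 sequentially] lim1 by simp
  qed (auto intro: tendsto_const)
qed

section \<open>Picard iteration\<close>

lemma nn_integral_Gker_dirac:
  assumes x: "x \<in> Dom n" and z: "z \<in> Dom n" and \<kappa>: "\<kappa> \<ge> 0"
  shows "(\<integral>\<^sup>+y. ennreal (Gker n x y t) * indicator (Dom n) y \<partial>dirac_mass n \<kappa> z) = ennreal (\<kappa> * Gker n x z t)"
proof -
  have [measurable]: "(\<lambda>y. Gker n x y t) \<in> borel_measurable (ptmeas n)"
    by (rule measurable_Gker) (use ptmeas_in_space[OF x] in auto)
  have [measurable]: "Dom n \<in> sets (ptmeas n)"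
    unfolding Dom_def ptmeas_def by measurable
  have "(\<lambda>y. ennreal (Gker n x y t) * indicator (Dom n) y) \<in> borel_measurable (ptmeas n)"
    by measurable
  then show ?thesis
    unfolding dirac_mass_def using z \<kappa> ptmeas_in_space[OF z]
    by (subst nn_integral_scale_measure)
       (auto simp: nn_integral_return ennreal_mult Gker_nonneg)
qed

lemma is_solution_dirac_iff:
  assumes "z \<in> Dom n" "\<kappa> \<ge> 0"
  shows "is_solution n p (dirac_mass n \<kappa> z) T u \<longleftrightarrow>
     (\<forall>x\<in>Dom n. \<forall>t\<in>{0<..<T}. 0 \<le> u x t) \<and>
     continuous_on (Dom n \<times> {0<..<T}) (\<lambda>(x, t). u x t) \<and>
     (\<forall>x\<in>Dom n. \<forall>t\<in>{0<..<T}.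
        ennreal (u x t) = ennreal (\<kappa> * Gker n x z t) + bpot n (\<lambda>y s. u (y, 0) s powr p) x t)"
  using assms by (simp add: is_solution_def nn_integral_Gker_dirac bpot_def)

text \<open>Only boundary values are iterated, since the flux depends on nothing else. An infinite
  potential would be read as 0 by \<open>enn2real\<close>; the bounds below exclude that case on the
  time interval of interest.\<close>

fun picard :: "nat \<Rightarrow> real \<Rightarrow> real \<Rightarrow> pt \<Rightarrow> nat \<Rightarrow> (nat \<Rightarrow> real) \<Rightarrow> real \<Rightarrow> real" where
  "picard n p \<kappa> z 0 y s = \<kappa> * Gker n (y, 0) z s"
| "picard n p \<kappa> z (Suc k) y s =
     \<kappa> * Gker n (y, 0) z s + enn2real (bpot n (\<lambda>y s. picard n p \<kappa> z k y s powr p) (y, 0) s)"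

lemma boundary_in_Dom: "y \<in> space (bmeas n) \<Longrightarrow> (y, 0) \<in> Dom n"
  by (simp add: Dom_def)

text \<open>Joint measurability in boundary point and time lets the Picard iterates feed back into
  the potential. It comes from two applications of the measurability of parameter integrals, hence
  the nested products.\<close>

lemma measurable_bpot:
  assumes f: "(\<lambda>\<omega>. f (fst \<omega>) (snd \<omega>)) \<in> borel_measurable (bmeas n \<Otimes>\<^sub>M lborel)"
  shows "(\<lambda>\<omega>. bpot n f (fst \<omega>, 0) (snd \<omega>)) \<in> borel_measurable (bmeas n \<Otimes>\<^sub>M lborel)"
proof -
  let ?M = "bmeas n \<Otimes>\<^sub>M (lborel :: real measure)"
  interpret sigma_finite_measure "bmeas n" by (rule sigma_finite_bmeas)
  have [measurable]: "(\<lambda>\<omega>. Gker n (fst (fst (fst \<omega>)), 0) (snd \<omega>, 0) (snd (fst (fst \<omega>)) - snd (fst \<omega>)))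
      \<in> borel_measurable ((?M \<Otimes>\<^sub>M lborel) \<Otimes>\<^sub>M bmeas n)"
  proof (rule measurable_Gker)
    show "(\<lambda>\<omega>. (fst (fst (fst \<omega>)), 0)) \<in> (?M \<Otimes>\<^sub>M (lborel::real measure)) \<Otimes>\<^sub>M bmeas n \<rightarrow>\<^sub>M ptmeas n"
      unfolding ptmeas_def by measurable
    show "(\<lambda>\<omega>. (snd \<omega>, 0)) \<in> (?M \<Otimes>\<^sub>M (lborel::real measure)) \<Otimes>\<^sub>M bmeas n \<rightarrow>\<^sub>M ptmeas n"
      unfolding ptmeas_def by measurable
  qed measurable
  have [measurable]: "(\<lambda>\<omega>. f (snd \<omega>) (snd (fst \<omega>))) \<in> borel_measurable ((?M \<Otimes>\<^sub>M (lborel::real measure)) \<Otimes>\<^sub>M bmeas n)"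
    using measurable_compose[of "\<lambda>\<omega>. (snd \<omega>, snd (fst \<omega>))" "(?M \<Otimes>\<^sub>M (lborel::real measure)) \<Otimes>\<^sub>M bmeas n" ?M, OF _ f]
    by simp
  show ?thesis
    unfolding bpot_def
  proof (intro lborel.borel_measurable_nn_integral)
    have [measurable]: "(\<lambda>\<omega>. indicator {0<..<snd (fst \<omega>)} (snd \<omega>) :: ennreal) \<in> borel_measurable (?M \<Otimes>\<^sub>M (lborel::real measure))"
      unfolding indicator_def greaterThanLessThan_iff by measurable
    have [measurable]: "(\<lambda>\<omega>. \<integral>\<^sup>+y. ennreal (Gker n (fst (fst \<omega>), 0) (y, 0) (snd (fst \<omega>) - snd \<omega>) * f y (snd \<omega>)) \<partial>bmeas n)
        \<in> borel_measurable (?M \<Otimes>\<^sub>M (lborel::real measure))"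
      by (intro borel_measurable_nn_integral) (simp add: split_beta')
    show "(\<lambda>(\<omega>, s). (\<integral>\<^sup>+y. ennreal (Gker n (fst \<omega>, 0) (y, 0) (snd \<omega> - s) * f y s) \<partial>bmeas n) * indicator {0<..<snd \<omega>} s)
        \<in> borel_measurable (?M \<Otimes>\<^sub>M lborel)"
      unfolding split_beta' by measurable
  qed
qed

lemma measurable_picard:
  assumes z: "z \<in> Dom n"
  shows "(\<lambda>\<omega>. picard n p \<kappa> z k (fst \<omega>) (snd \<omega>)) \<in> borel_measurable (bmeas n \<Otimes>\<^sub>M lborel)"
proof (induction k)
  case 0
  have "(\<lambda>\<omega>. Gker n (fst \<omega>, 0) z (snd \<omega>)) \<in> borel_measurable (bmeas n \<Otimes>\<^sub>M (lborel::real measure))"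
    by (rule measurable_Gker[OF ptmeas_pair_boundary]) (use ptmeas_in_space[OF z] in auto)
  then show ?case by simp
next
  case (Suc k)
  have "(\<lambda>\<omega>. Gker n (fst \<omega>, 0) z (snd \<omega>)) \<in> borel_measurable (bmeas n \<Otimes>\<^sub>M (lborel::real measure))"
    by (rule measurable_Gker[OF ptmeas_pair_boundary]) (use ptmeas_in_space[OF z] in auto)
  moreover have "(\<lambda>\<omega>. bpot n (\<lambda>y s. picard n p \<kappa> z k y s powr p) (fst \<omega>, 0) (snd \<omega>)) \<in> borel_measurable (bmeas n \<Otimes>\<^sub>M (lborel::real measure))"
    by (rule measurable_bpot) (use Suc in measurable)
  ultimately show ?case by simp
qed

lemma picard_nonneg: "\<kappa> \<ge> 0 \<Longrightarrow> 0 \<le> picard n p \<kappa> z k y s"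
  by (cases k) (auto intro!: add_nonneg_nonneg mult_nonneg_nonneg Gker_nonneg)

lemma bpot_finite:
  assumes "\<And>y s. y \<in> space (bmeas n) \<Longrightarrow> 0 < s \<Longrightarrow> s < t \<Longrightarrow> f y s \<le> 1" "t \<ge> 0"
  shows "bpot n f x t < top"
  using bpot_le[of n t f x, OF assms] by (auto simp: order.strict_trans1)

lemma enn2real_bpot_le:
  assumes "\<And>y s. y \<in> space (bmeas n) \<Longrightarrow> 0 < s \<Longrightarrow> s < t \<Longrightarrow> f y s \<le> 1" "t \<ge> 0"
  shows "enn2real (bpot n f x t) \<le> 2 * sqrt t"
  using enn2real_mono[OF bpot_le[of n t f x, OF assms]] assms(2) by simp

text \<open>The kernel itself dominates, because its integral is the potential of the constant 1 and
  hence finite.\<close>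

lemma bpot_dominated_convergence:
  assumes f[measurable]: "\<And>k. (\<lambda>\<omega>. f k (fst \<omega>) (snd \<omega>)) \<in> borel_measurable (bmeas n \<Otimes>\<^sub>M lborel)"
      "(\<lambda>\<omega>. g (fst \<omega>) (snd \<omega>)) \<in> borel_measurable (bmeas n \<Otimes>\<^sub>M lborel)"
    and le: "\<And>k y s. y \<in> space (bmeas n) \<Longrightarrow> 0 < s \<Longrightarrow> s < t \<Longrightarrow> f k y s \<le> 1"
    and lim: "\<And>y s. y \<in> space (bmeas n) \<Longrightarrow> 0 < s \<Longrightarrow> s < t \<Longrightarrow> (\<lambda>k. f k y s) \<longlonglongrightarrow> g y s"
    and x: "x \<in> Dom n" and t: "t \<ge> 0"
  shows "(\<lambda>k. bpot n (f k) x t) \<longlonglongrightarrow> bpot n g x t"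
proof -
  note [measurable] = measurable_Gker_boundary[OF x]
  show ?thesis
    unfolding bpot_pair[OF x f(1)] bpot_pair[OF x f(2)]
  proof (rule nn_integral_dominated_convergence[where
        w = "\<lambda>\<omega>. ennreal (Gker n x (fst \<omega>, 0) (t - snd \<omega>) * indicator {0<..<t} (snd \<omega>) * 1)"])
    show "(\<integral>\<^sup>+\<omega>. ennreal (Gker n x (fst \<omega>, 0) (t - snd \<omega>) * indicator {0<..<t} (snd \<omega>) * 1) \<partial>(bmeas n \<Otimes>\<^sub>M lborel)) < \<infinity>"
      using bpot_finite[of n t "\<lambda>_ _. 1" x] t by (subst bpot_pair[OF x, symmetric]) auto
    show "AE \<omega> in bmeas n \<Otimes>\<^sub>M lborel. ennreal (Gker n x (fst \<omega>, 0) (t - snd \<omega>) * indicator {0<..<t} (snd \<omega>) * f k (fst \<omega>) (snd \<omega>))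
        \<le> ennreal (Gker n x (fst \<omega>, 0) (t - snd \<omega>) * indicator {0<..<t} (snd \<omega>) * 1)" for k
      by (intro AE_I2 ennreal_leI)
         (auto simp: indicator_def space_pair_measure Gker_nonneg intro!: mult_left_le le)
    show "AE \<omega> in bmeas n \<Otimes>\<^sub>M lborel. (\<lambda>k. ennreal (Gker n x (fst \<omega>, 0) (t - snd \<omega>) * indicator {0<..<t} (snd \<omega>) * f k (fst \<omega>) (snd \<omega>)))
        \<longlonglongrightarrow> ennreal (Gker n x (fst \<omega>, 0) (t - snd \<omega>) * indicator {0<..<t} (snd \<omega>) * g (fst \<omega>) (snd \<omega>))"
      by (intro AE_I2 tendsto_ennrealI)
         (auto simp: indicator_def space_pair_measure intro!: tendsto_mult tendsto_const lim)
  qed measurable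
qed

text \<open>The iterates are trapped in \<open>[0, 1]\<close> and increase, so they converge.
  Dominated convergence turns the recursion into the integral equation, and every solution lies
  above all iterates, hence above their limit.\<close>

lemma minimal_solution_exists:
  assumes p: "p > 1" and z: "z \<in> Dom n" and \<kappa>: "\<kappa> \<ge> 0" and T: "4 * sqrt T \<le> 1"
    and small: "\<And>y s. y \<in> space (bmeas n) \<Longrightarrow> 0 < s \<Longrightarrow> s < T \<Longrightarrow> \<kappa> * Gker n (y, 0) z s \<le> 1/2"
  shows "\<exists>u. is_minimal_solution n p (dirac_mass n \<kappa> z) T u"
proof -
  define w where "w = picard n p \<kappa> z"
  have w_Suc: "w (Suc k) y s = \<kappa> * Gker n (y, 0) z s + enn2real (bpot n (\<lambda>y s. w k y s powr p) (y, 0) s)" for k y s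
    by (simp add: w_def)
  have w0: "0 \<le> w k y s" for k y s
    unfolding w_def by (rule picard_nonneg[OF \<kappa>])
  have [measurable]: "(\<lambda>\<omega>. w k (fst \<omega>) (snd \<omega>)) \<in> borel_measurable (bmeas n \<Otimes>\<^sub>M lborel)" for k
    unfolding w_def by (rule measurable_picard[OF z])
  have powr_le1: "a powr p \<le> 1" if "0 \<le> a" "a \<le> 1" for a
    using that p powr_mono2[of p a 1] by simp
  \<comment> \<open>The bound 1 reproduces itself: the datum contributes at most 1/2, and a density
    at most 1 contributes at most \<open>2 * sqrt T\<close>, which is again at most 1/2.\<close>
  have w1: "w k y s \<le> 1" if "y \<in> space (bmeas n)" "0 < s" "s < T" for k y s
    using that
  proof (induction k arbitrary: y s)
    case 0
    then show ?case using small[of y s] by (simp add: w_def)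
  next
    case (Suc k)
    have "enn2real (bpot n (\<lambda>y s. w k y s powr p) (y, 0) s) \<le> 2 * sqrt s"
      by (rule enn2real_bpot_le) (use Suc powr_le1 w0 in auto)
    moreover have "sqrt s \<le> sqrt T" using Suc.prems by simp
    ultimately show ?case using small[OF Suc.prems] T unfolding w_Suc by linarith
  qed
  \<comment> \<open>Finiteness rules out the default value of \<open>enn2real\<close>, so the
    recursion for \<open>w\<close> may be read in \<open>ennreal\<close> as well.\<close>
  have wfin: "bpot n (\<lambda>y s. w k y s powr p) x t < top" if "t < T" "0 < t" for k x t
    by (rule bpot_finite) (use that powr_le1 w0 w1 in auto)
  have mono: "w k y s \<le> w (Suc k) y s" if "y \<in> space (bmeas n)" "0 < s" "s < T" for k y s
    using that
  proof (induction k arbitrary: y s)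
    case 0
    then show ?case by (simp add: w_def)
  next
    case (Suc k)
    have "bpot n (\<lambda>y s. w k y s powr p) (y, 0) s \<le> bpot n (\<lambda>y s. w (Suc k) y s powr p) (y, 0) s"
      by (rule bpot_mono) (use Suc p w0 in \<open>auto intro!: powr_mono2\<close>)
    then show ?case
      using wfin[of s "Suc k" "(y,0)"] Suc.prems
      by (simp add: w_Suc[of "Suc k"] w_Suc[of k] del: picard.simps) (simp add: enn2real_mono)
  qed
  \<comment> \<open>\<open>lim\<close> is total, so \<open>W\<close> is measurable everywhere; it is
    the limit of the iterates only for times in \<open>{0<..<T}\<close>.\<close>
  define W where "W y s = lim (\<lambda>k. w k y s)" for y s
  have [measurable]: "(\<lambda>\<omega>. W (fst \<omega>) (snd \<omega>)) \<in> borel_measurable (bmeas n \<Otimes>\<^sub>M lborel)"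
    unfolding W_def by measurable
  have Wlim: "(\<lambda>k. w k y s) \<longlonglongrightarrow> W y s" if "y \<in> space (bmeas n)" "0 < s" "s < T" for y s
  proof -
    have "incseq (\<lambda>k. w k y s)"
      using mono[OF that] by (rule incseq_SucI)
    moreover have "Bseq (\<lambda>k. w k y s)"
      using w0 w1[OF that] by (intro BseqI'[of _ 1]) auto
    ultimately have "convergent (\<lambda>k. w k y s)"
      by (intro Bseq_monoseq_convergent incseq_imp_monoseq)
    then show ?thesis unfolding W_def by (simp add: convergent_LIMSEQ_iff)
  qed
  have W0: "0 \<le> W y s" and W1: "W y s \<le> 1" if "y \<in> space (bmeas n)" "0 < s" "s < T" for y s
    using LIMSEQ_le_const[OF Wlim[OF that]] LIMSEQ_le_const2[OF Wlim[OF that]] w0 w1[OF that] by blast+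
  \<comment> \<open>One more application of the integral operator extends the boundary limit to the
    whole half-space. Agreement with \<open>W\<close> on the boundary is shown in
    \<open>uW\<close>.\<close>
  define u where "u x t = \<kappa> * Gker n x z t + enn2real (bpot n (\<lambda>y s. W y s powr p) x t)" for x t
  have u0: "0 \<le> u x t" for x t
    using \<kappa> by (simp add: u_def Gker_nonneg)
  have Wp1: "0 \<le> W y s powr p \<and> W y s powr p \<le> 1" if "y \<in> space (bmeas n)" "0 < s" "s < T" for y s
    using that powr_le1 W0 W1 by auto
  have Wfin: "bpot n (\<lambda>y s. W y s powr p) x t < top" if "t < T" "0 < t" for x t
    by (rule bpot_finite) (use that Wp1 in auto)
  \<comment> \<open>Passing to the limit in the recursion shows that \<open>w (Suc k) y s\<close>
    tends to \<open>u (y, 0) s\<close>, while it also tends to \<open>W y s\<close>.\<close>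
  have uW: "u (y, 0) s = W y s" if ys: "y \<in> space (bmeas n)" "0 < s" "s < T" for y s
  proof -
    have "(\<lambda>k. bpot n (\<lambda>y s. w k y s powr p) (y, 0) s) \<longlonglongrightarrow> bpot n (\<lambda>y s. W y s powr p) (y, 0) s"
    proof (rule bpot_dominated_convergence)
      fix y' s' assume "y' \<in> space (bmeas n)" "0 < s'" "s' < s"
      then show "(\<lambda>k. w k y' s' powr p) \<longlonglongrightarrow> W y' s' powr p"
        using ys p w0 by (intro tendsto_powr2 Wlim tendsto_const) auto
    qed (use ys boundary_in_Dom w0 w1 powr_le1 in auto)
    then have "(\<lambda>k. enn2real (bpot n (\<lambda>y s. w k y s powr p) (y, 0) s)) \<longlonglongrightarrow> enn2real (bpot n (\<lambda>y s. W y s powr p) (y, 0) s)"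
      using Wfin[of s "(y, 0)"] ys by (intro tendsto_enn2real) auto
    then have "(\<lambda>k. w (Suc k) y s) \<longlonglongrightarrow> u (y, 0) s"
      unfolding w_Suc u_def by (intro tendsto_add tendsto_const)
    then show ?thesis
      using LIMSEQ_unique LIMSEQ_Suc[OF Wlim[OF ys]] by blast
  qed
  have eq: "ennreal (u x t) = ennreal (\<kappa> * Gker n x z t) + bpot n (\<lambda>y s. u (y, 0) s powr p) x t"
    if "x \<in> Dom n" "0 < t" "t < T" for x t
  proof -
    have "bpot n (\<lambda>y s. u (y, 0) s powr p) x t = bpot n (\<lambda>y s. W y s powr p) x t"
      by (rule bpot_cong) (use uW that in auto)
    then show ?thesis
      using Wfin[of t x] that \<kappa> by (simp add: u_def Gker_nonneg)
  qed
  have cont: "continuous_on (Dom n \<times> {0<..<T}) (\<lambda>(x, t). u x t)"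
    unfolding continuous_on_sequentially
  proof (intro allI ballI impI, elim conjE)
    fix X :: "nat \<Rightarrow> pt \<times> real" and a
    assume a: "a \<in> Dom n \<times> {0<..<T}" and X: "\<forall>k. X k \<in> Dom n \<times> {0<..<T}" and lim: "X \<longlonglongrightarrow> a"
    obtain x t where [simp]: "a = (x, t)" by (cases a)
    have lx: "(\<lambda>k. fst (X k)) \<longlonglongrightarrow> x" and lt: "(\<lambda>k. snd (X k)) \<longlonglongrightarrow> t"
      using tendsto_fst[OF lim] tendsto_snd[OF lim] by auto
    \<comment> \<open>The tangential part carries the product topology, so convergence of points
      gives convergence of each coordinate, which is all the kernel sees.\<close>
    have l1: "(\<lambda>k. fst (fst (X k)) i) \<longlonglongrightarrow> fst x i" for i
      using continuous_on_tendsto_compose[OF continuous_on_product_coordinates[of i] tendsto_fst[OF lx]] by simp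
    have l2: "(\<lambda>k. snd (fst (X k))) \<longlonglongrightarrow> snd x"
      using tendsto_snd[OF lx] .
    have "(\<lambda>k. enn2real (bpot n (\<lambda>y s. W y s powr p) (fst (X k)) (snd (X k)))) \<longlonglongrightarrow> enn2real (bpot n (\<lambda>y s. W y s powr p) x t)"
    proof (rule bpot_tendsto[where T = T])
      show "fst (X k) \<in> Dom n" "0 < snd (X k) \<and> snd (X k) < T" for k
        using X[rule_format, of k] by (auto simp: mem_Times_iff)
    qed (use a Wp1 l1 l2 lt in \<open>auto\<close>)
    then have "(\<lambda>k. u (fst (X k)) (snd (X k))) \<longlonglongrightarrow> u x t"
      unfolding u_def using a
      by (intro tendsto_add tendsto_mult Gker_tendsto tendsto_const l1 l2 lt) auto
    then show "((\<lambda>(x, t). u x t) \<circ> X) \<longlonglongrightarrow> (case a of (x, t) \<Rightarrow> u x t)"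
      by (simp add: comp_def split_beta')
  qed
  \<comment> \<open>The comparison is first made between boundary values, by induction on the
    iterates, and then carried to every point by monotonicity of the potential.\<close>
  have min: "u x t \<le> v x t" if v: "is_solution n p (dirac_mass n \<kappa> z) T v" and xt: "x \<in> Dom n" "0 < t" "t < T" for v x t
  proof -
    have v0: "0 \<le> v x t" and veq: "ennreal (v x t) = ennreal (\<kappa> * Gker n x z t) + bpot n (\<lambda>y s. v (y, 0) s powr p) x t"
      if "x \<in> Dom n" "0 < t" "t < T" for x t
      using v that unfolding is_solution_dirac_iff[OF z \<kappa>] by auto
    have wv: "w k y s \<le> v (y, 0) s" if "y \<in> space (bmeas n)" "0 < s" "s < T" for k y s
      using that
    proof (induction k arbitrary: y s)
      case 0
      have "ennreal (w 0 y s) \<le> ennreal (v (y, 0) s)"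
        using veq[of "(y, 0)" s] 0 boundary_in_Dom by (simp add: w_def)
      then show ?case using v0[of "(y, 0)" s] 0 boundary_in_Dom by (simp add: ennreal_le_iff)
    next
      case (Suc k)
      have "bpot n (\<lambda>y s. w k y s powr p) (y, 0) s \<le> bpot n (\<lambda>y s. v (y, 0) s powr p) (y, 0) s"
        by (rule bpot_mono) (use Suc p w0 in \<open>auto intro!: powr_mono2\<close>)
      moreover have "ennreal (w (Suc k) y s) = ennreal (\<kappa> * Gker n (y, 0) z s) + bpot n (\<lambda>y s. w k y s powr p) (y, 0) s"
        using wfin[of s k "(y, 0)"] Suc.prems \<kappa> by (simp add: w_Suc Gker_nonneg)
      ultimately have "ennreal (w (Suc k) y s) \<le> ennreal (v (y, 0) s)"
        using veq[of "(y, 0)" s] Suc.prems boundary_in_Dom by (simp add: add_left_mono)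
      then show ?case using v0[of "(y, 0)" s] Suc.prems boundary_in_Dom by (simp add: ennreal_le_iff)
    qed
    have Wv: "W y s \<le> v (y, 0) s" if "y \<in> space (bmeas n)" "0 < s" "s < T" for y s
      by (rule LIMSEQ_le_const2[OF Wlim[OF that]]) (use wv that in auto)
    have "bpot n (\<lambda>y s. u (y, 0) s powr p) x t \<le> bpot n (\<lambda>y s. v (y, 0) s powr p) x t"
      by (rule bpot_mono) (use Wv uW W0 p xt in \<open>auto intro!: powr_mono2\<close>)
    then have "ennreal (u x t) \<le> ennreal (v x t)"
      using eq[OF xt] veq[OF xt] by (simp add: add_left_mono)
    then show ?thesis using v0[OF xt] by (simp add: ennreal_le_iff)
  qed
  show ?thesis
    unfolding is_minimal_solution_def
    by (intro exI[of _ u] conjI allI impI ballI)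
       (use min eq cont u0 in \<open>auto simp: is_solution_dirac_iff[OF z \<kappa>]\<close>)
qed

section \<open>Blow-up on the boundary\<close>

definition cube :: "nat \<Rightarrow> (nat \<Rightarrow> real) \<Rightarrow> real \<Rightarrow> (nat \<Rightarrow> real) set" where
  "cube n a r = (\<Pi>\<^sub>E i\<in>{..<n}. {a i - r..a i + r})"

text \<open>The factor 2 is the boundary doubling of the kernel. On a box of side
  \<open>sqrt \<tau>\<close> with corner at the pole the squared distance is at most
  \<open>n * \<tau>\<close>, which gives \<open>exp (- n / 4)\<close>; the powers of
  \<open>\<tau>\<close> are kept outside.\<close>

definition box_const :: "nat \<Rightarrow> real" where
  "box_const n = 2 * (4 * pi) powr (- (real n + 1) / 2) * exp (- real n / 4)"

lemma box_const_pos: "0 < box_const n"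
  by (simp add: box_const_def)

lemma sets_PiE_bmeas: "(\<And>i. i < n \<Longrightarrow> A i \<in> sets borel) \<Longrightarrow> (\<Pi>\<^sub>E i\<in>{..<n}. A i) \<in> sets (bmeas n)"
  unfolding bmeas_def by (intro sets_PiM_I_finite) auto

lemma cube_subset_space: "cube n a r \<subseteq> space (bmeas n)"
  by (auto simp: cube_def space_bmeas)

text \<open>At every point of the cube there is a subbox of side \<open>sqrt \<tau>\<close>, with a corner at that point,
  which stays inside the cube; on it the kernel is comparable to its maximum.\<close>

lemma nn_integral_Gker_cube_ge:
  assumes y0: "y0 \<in> cube n a r" and \<tau>: "0 < \<tau>" "\<tau> \<le> r\<^sup>2" and r: "r > 0"
  shows "ennreal (box_const n * \<tau> powr (-1/2)) \<le> (\<integral>\<^sup>+y. ennreal (Gker n (y0, 0) (y, 0) \<tau>) * indicator (cube n a r) y \<partial>bmeas n)"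
proof -
  interpret product_sigma_finite "\<lambda>_::nat. lborel :: real measure" ..
  \<comment> \<open>Each side points from \<open>y0 i\<close> towards the centre \<open>a i\<close>;
    as its length is at most \<open>r\<close>, it cannot leave the cube.\<close>
  define I where "I i = (if y0 i \<le> a i then {y0 i..y0 i + sqrt \<tau>} else {y0 i - sqrt \<tau>..y0 i})" for i
  define B where "B = (\<Pi>\<^sub>E i\<in>{..<n}. I i)"
  have sq: "0 < sqrt \<tau>" "sqrt \<tau> \<le> r"
    using \<tau> r real_sqrt_le_mono[of \<tau> "r\<^sup>2"] by auto
  have y0': "a i - r \<le> y0 i" "y0 i \<le> a i + r" if "i < n" for i
    using y0 that by (auto simp: cube_def PiE_iff)
  have "I i \<subseteq> {a i - r..a i + r}" if "i < n" for i
    using y0'[OF that] sq by (auto simp: I_def)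
  then have BQ: "B \<subseteq> cube n a r"
    unfolding B_def cube_def by (intro PiE_mono) auto
  have Bm: "B \<in> sets (bmeas n)"
    unfolding B_def by (intro sets_PiE_bmeas) (auto simp: I_def)
  have emB: "emeasure (bmeas n) B = ennreal (\<tau> powr (real n / 2))"
  proof -
    have "emeasure (bmeas n) B = (\<Prod>i<n. emeasure lborel (I i))"
      unfolding bmeas_def B_def by (rule emeasure_PiM) (auto simp: I_def)
    also have "\<dots> = (\<Prod>i<n. ennreal (sqrt \<tau>))"
      using sq by (intro prod.cong) (auto simp: I_def)
    also have "\<dots> = ennreal (sqrt \<tau> ^ n)"
      using sq by (simp add: ennreal_power)
    also have "sqrt \<tau> ^ n = \<tau> powr (real n / 2)"
      using \<tau> by (simp add: powr_half_sqrt[symmetric] powr_power)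
    finally show ?thesis .
  qed
  define m where "m = 2 * (4 * pi * \<tau>) powr (- (real n + 1) / 2) * exp (- real n / 4)"
  have G: "m \<le> Gker n (y0, 0) (y, 0) \<tau>" if "y \<in> B" for y
  proof -
    have "(y0 i - y i)\<^sup>2 \<le> \<tau>" if "i < n" for i
    proof -
      have "\<bar>y0 i - y i\<bar> \<le> sqrt \<tau>"
      proof -
        have "y i \<in> I i" using \<open>y \<in> B\<close> that by (auto simp: B_def PiE_iff)
        then show ?thesis by (auto simp: I_def abs_le_iff split: if_splits)
      qed
      then have "(y0 i - y i)\<^sup>2 \<le> (sqrt \<tau>)\<^sup>2" by (rule power2_le_iff_abs_le[THEN iffD2, rotated]) (use sq in auto)
      then show ?thesis using \<tau> by simp
    qed
    then have "(\<Sum>i<n. (y0 i - y i)\<^sup>2) \<le> (\<Sum>i<n. \<tau>)" by (intro sum_mono) auto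
    then have "sqdist n (y0, 0) (y, 0) \<le> real n * \<tau>"
      by (simp add: sqdist_def)
    then have "- real n / 4 \<le> - sqdist n (y0, 0) (y, 0) / (4 * \<tau>)"
      using \<tau> by (simp add: field_simps)
    then show ?thesis
      unfolding Gker_boundary heat_def m_def by (simp add: mult_left_mono)
  qed
  \<comment> \<open>The kernel has size \<open>\<tau>\<close> to the power \<open>-(n + 1)/2\<close>
    and the box has volume \<open>\<tau>\<close> to the power \<open>n/2\<close>; the exponents add
    up to -1/2.\<close>
  have "box_const n * \<tau> powr (-1/2) = m * \<tau> powr (real n / 2)"
  proof -
    have e: "\<tau> powr (-1/2) = \<tau> powr (- (real n + 1) / 2) * \<tau> powr (real n / 2)"
      by (subst powr_add[symmetric]) (simp add: field_simps)
    show ?thesis unfolding e using \<tau> by (simp add: box_const_def m_def powr_mult)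
  qed
  also have "ennreal (m * \<tau> powr (real n / 2)) = (\<integral>\<^sup>+y. ennreal m * indicator B y \<partial>bmeas n)"
    using Bm emB by (subst nn_integral_cmult_indicator) (auto simp: ennreal_mult m_def)
  also have "\<dots> \<le> (\<integral>\<^sup>+y. ennreal (Gker n (y0, 0) (y, 0) \<tau>) * indicator (cube n a r) y \<partial>bmeas n)"
    using G BQ by (intro nn_integral_mono) (auto simp: indicator_def intro!: ennreal_leI)
  finally show ?thesis .
qed

text \<open>Contributions from outside the cube and from times before \<open>b\<close> are dropped.
  The remaining kernel mass is at least \<open>box_const n * (t - s) powr (-1/2)\<close>, and as
  \<open>t - s\<close> is at most 1 the power is bounded below by 1. The resulting bound, linear in
  \<open>t - b\<close>, is enough for the iteration.\<close>

lemma bpot_cube_ge: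
  assumes y0: "y0 \<in> cube n a r" and r: "r > 0" and m: "m \<ge> 0"
    and b: "0 \<le> b" "b < t" "t - b \<le> 1" "t - b \<le> r\<^sup>2"
    and f: "\<And>y s. y \<in> cube n a r \<Longrightarrow> b < s \<Longrightarrow> s < t \<Longrightarrow> m \<le> f y s"
  shows "ennreal (box_const n * m * (t - b)) \<le> bpot n f (y0, 0) t"
proof -
  have "ennreal (box_const n * m * (t - b)) = (\<integral>\<^sup>+s. ennreal (box_const n * m) * indicator {b<..<t} s \<partial>lborel)"
    using b m box_const_pos[of n] by (subst nn_integral_cmult_indicator) (auto simp: ennreal_mult)
  also have "\<dots> \<le> bpot n f (y0, 0) t"
    unfolding bpot_def
  proof (intro nn_integral_mono)
    fix s
    show "ennreal (box_const n * m) * indicator {b<..<t} s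
      \<le> (\<integral>\<^sup>+y. ennreal (Gker n (y0, 0) (y, 0) (t - s) * f y s) \<partial>bmeas n) * indicator {0<..<t} s"
    proof (cases "b < s \<and> s < t")
      case True
      have "1 \<le> (t - s) powr (-1/2)"
        using True b powr_mono2'[of "-1/2" "t - s" 1] by simp
      then have "ennreal (box_const n * m) \<le> ennreal m * ennreal (box_const n * (t - s) powr (-1/2))"
        using m box_const_pos[of n] by (subst ennreal_mult[symmetric]) (auto intro!: ennreal_leI mult_left_mono simp: mult_ac)
      also have "\<dots> \<le> ennreal m * (\<integral>\<^sup>+y. ennreal (Gker n (y0, 0) (y, 0) (t - s)) * indicator (cube n a r) y \<partial>bmeas n)"
        using True b by (intro mult_left_mono nn_integral_Gker_cube_ge y0 r) auto
      also have "\<dots> = (\<integral>\<^sup>+y. ennreal m * (ennreal (Gker n (y0, 0) (y, 0) (t - s)) * indicator (cube n a r) y) \<partial>bmeas n)"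
      proof (rule nn_integral_cmult[symmetric])
        have [measurable]: "cube n a r \<in> sets (bmeas n)"
          unfolding cube_def by (rule sets_PiE_bmeas) auto
        have [measurable]: "(\<lambda>y. Gker n (y0, 0) (y, 0) (t - s)) \<in> borel_measurable (bmeas n)"
          unfolding Gker_boundary heat_def sqdist_def bmeas_def by simp
        show "(\<lambda>y. ennreal (Gker n (y0, 0) (y, 0) (t - s)) * indicator (cube n a r) y) \<in> borel_measurable (bmeas n)"
          by measurable
      qed
      also have "\<dots> \<le> (\<integral>\<^sup>+y. ennreal (Gker n (y0, 0) (y, 0) (t - s) * f y s) \<partial>bmeas n)"
        using True f m
        by (intro nn_integral_mono)
           (auto simp: indicator_def ennreal_mult[symmetric] Gker_nonneg mult.commute[of m] intro!: ennreal_leI mult_left_mono)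
      finally show ?thesis using True b by simp
    qed auto
  qed
  finally show ?thesis .
qed

text \<open>Halving the remaining time at each step, every pass through the integral equation multiplies
  the lower bound on the cube by the fixed factor \<open>2 powr (1 / (p - 1)) > 1\<close>.\<close>

lemma boundary_blow_up:
  fixes v :: "(nat \<Rightarrow> real) \<Rightarrow> real \<Rightarrow> real"
  assumes p: "p > 1" and r: "r > 0" and \<sigma>: "\<sigma> \<ge> 0" and H: "0 < H" "H \<le> 1" "H \<le> r\<^sup>2"
    and A: "A > 0" and a: "a \<in> space (bmeas n)"
    and lower: "\<And>y t. y \<in> cube n a r \<Longrightarrow> \<sigma> < t \<Longrightarrow> t \<le> \<sigma> + H \<Longrightarrow> A \<le> v y t"
    and super: "\<And>y t. y \<in> cube n a r \<Longrightarrow> \<sigma> < t \<Longrightarrow> t \<le> \<sigma> + H \<Longrightarrow>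
        bpot n (\<lambda>y s. v y s powr p) (y, 0) t \<le> ennreal (v y t)"
  shows "box_const n * H * A powr (p - 1) < 2 * 2 powr (1 / (p - 1))"
proof (rule ccontr)
  \<comment> \<open>Chosen so that \<open>l powr (p - 1) = 2\<close>: raising the lower bound by the
    factor \<open>l\<close> exactly pays for halving the available time.\<close>
  define l :: real where "l = 2 powr (1 / (p - 1))"
  assume "\<not> box_const n * H * A powr (p - 1) < 2 * 2 powr (1 / (p - 1))"
  then have big: "2 * l \<le> box_const n * H * A powr (p - 1)" by (simp add: l_def)
  have l: "l > 1" using p by (simp add: l_def)
  have lp: "l powr (p - 1) = 2" using p by (simp add: l_def powr_powr)
  \<comment> \<open>Stage \<open>k\<close> starts when only the fraction \<open>(1/2) ^ k\<close> of
    the window of length \<open>H\<close> is left, so the final time \<open>\<sigma> + H\<close>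
    belongs to every stage.\<close>
  have claim: "A * l ^ k \<le> v y t" if "y \<in> cube n a r" "\<sigma> + H * (1 - (1/2) ^ k) < t" "t \<le> \<sigma> + H" for k y t
    using that
  proof (induction k arbitrary: y t)
    case 0
    then show ?case using lower by simp
  next
    case (Suc k)
    define b where "b = \<sigma> + H * (1 - (1/2) ^ k)"
    define m where "m = A * l ^ k"
    have m: "m > 0" using A l by (simp add: m_def)
    have b0: "\<sigma> \<le> b" using H by (simp add: b_def power_le_one)
    have tb: "H * (1/2) ^ Suc k \<le> t - b" using Suc.prems by (simp add: b_def field_simps)
    moreover have "0 < H * (1/2) ^ Suc k" using H by simp
    ultimately have bt: "b < t" by linarith
    have "ennreal (box_const n * m powr p * (t - b)) \<le> bpot n (\<lambda>y s. v y s powr p) (y, 0) t"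
    proof (rule bpot_cube_ge[OF Suc.prems(1) r])
      show "m powr p \<le> v y' s powr p" if "y' \<in> cube n a r" "b < s" "s < t" for y' s
        using Suc.IH[OF that(1), of s] that Suc.prems m p unfolding b_def m_def by (intro powr_mono2) auto
    qed (use b0 \<sigma> bt H Suc.prems in auto)
    also have "\<dots> \<le> ennreal (v y t)"
      using Suc.prems b0 bt by (intro super) auto
    finally have 1: "box_const n * m powr p * (t - b) \<le> v y t"
      using lower[OF Suc.prems(1), of t] A b0 bt Suc.prems by (subst (asm) ennreal_le_iff) auto
    have "m powr p = m * m powr (p - 1)"
      using m by (simp add: powr_diff)
    also have "m powr (p - 1) = A powr (p - 1) * 2 ^ k"
    proof -
      have "(l ^ k) powr (p - 1) = (l powr (p - 1)) ^ k"
        using l by (induction k) (auto simp: powr_mult)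
      then show ?thesis using A l lp by (simp add: m_def powr_mult)
    qed
    finally have mp: "m powr p = m * (A powr (p - 1) * 2 ^ k)" .
    \<comment> \<open>The factor \<open>2 ^ k\<close> from \<open>m powr (p - 1)\<close> cancels
      against the waiting time \<open>H * (1/2) ^ Suc k\<close> up to 1/2, and \<open>big\<close>
      supplies the missing \<open>2 * l\<close>.\<close>
    have "A * l ^ Suc k = m * (2 * l) * (1/2)" by (simp add: m_def)
    also have "\<dots> \<le> m * (box_const n * H * A powr (p - 1)) * (1/2)"
      using big m by (intro mult_right_mono mult_left_mono) auto
    also have "\<dots> = box_const n * m powr p * (H * (1/2) ^ Suc k)"
      by (simp add: mp field_simps)
    also have "\<dots> \<le> box_const n * m powr p * (t - b)"
      using tb box_const_pos[of n] by (intro mult_left_mono) auto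
    finally show ?case using 1 by simp
  qed
  have "a \<in> cube n a r"
    using a r by (auto simp: cube_def space_bmeas PiE_iff)
  \<comment> \<open>At the final time all stages apply at once, so one real number would bound all
    powers of \<open>l > 1\<close>.\<close>
  then have bound: "l ^ k \<le> v a (\<sigma> + H) / A" for k
    using claim[of a k "\<sigma> + H"] H A by (simp add: field_simps)
  obtain k where "v a (\<sigma> + H) / A < l ^ k"
    using real_arch_pow[OF l] by blast
  then show False using bound[of k] by simp
qed

section \<open>The life span for large mass\<close>

text \<open>The surplus \<open>\<epsilon>\<close> is split into thirds: one covers the tangential
  distance within the cube, one yields the positive exponent \<open>d\<close>, and one is the time
  \<open>\<epsilon> / 3 / ln \<kappa>\<close> left for the blow-up after \<open>t0\<close>.\<close>

lemma eventually_no_solution: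
  assumes p: "p > 1" and z: "fst z \<in> space (bmeas n)" "snd z > 0" and \<epsilon>: "\<epsilon> > 0"
  shows "\<forall>\<^sub>F \<kappa> in at_top. \<forall>T u. is_solution n p (dirac_mass n \<kappa> z) T u \<longrightarrow> T \<le> ((snd z)\<^sup>2 / 4 + \<epsilon>) / ln \<kappa>"
proof -
  define a where "a = (snd z)\<^sup>2 / 4"
  \<comment> \<open>This makes \<open>n * r^2 / 4\<close> at most \<open>\<epsilon> / 3\<close>;
    using \<open>n + 1\<close> in the denominator also covers \<open>n = 0\<close>.\<close>
  define r where "r = sqrt (4 * \<epsilon> / (3 * (real n + 1)))"
  \<comment> \<open>Determined by \<open>\<kappa> * exp (- (a + \<epsilon> / 3) / t0) = \<kappa>
    powr d\<close> at \<open>t0 = (a + 2 * \<epsilon> / 3) / ln \<kappa>\<close>.\<close>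
  define d where "d = (\<epsilon> / 3) / (a + 2 * \<epsilon> / 3)"
  have a0: "a > 0" using z by (simp add: a_def)
  have r0: "r > 0" using \<epsilon> by (simp add: r_def)
  have r2: "r\<^sup>2 = 4 * \<epsilon> / (3 * (real n + 1))" using \<epsilon> by (simp add: r_def)
  have nr: "real n * r\<^sup>2 / 4 \<le> \<epsilon> / 3"
    unfolding r2 using \<epsilon> by (simp add: field_simps)
  have d0: "d > 0" using a0 \<epsilon> by (simp add: d_def)
  have zD: "z \<in> Dom n" using z by (cases z) (simp add: Dom_def)
  define C where "C = 2 * 2 powr (1 / (p - 1))"
  \<comment> \<open>The power of \<open>\<kappa>\<close> beats the logarithm lost through the short
    time window, so the threshold of \<open>boundary_blow_up\<close> is eventually exceeded.\<close>
  have "filterlim (\<lambda>\<kappa>::real. box_const n * (\<epsilon> / 3 / ln \<kappa>) * (\<kappa> powr d) powr (p - 1)) at_top at_top"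
  proof -
    have "0 < box_const n * (\<epsilon> / 3)" "0 < d * (p - 1)"
      using box_const_pos[of n] \<epsilon> d0 p by auto
    then have "filterlim (\<lambda>\<kappa>::real. (box_const n * (\<epsilon> / 3)) * \<kappa> powr (d * (p - 1)) / ln \<kappa>) at_top at_top"
      by real_asymp
    then show ?thesis by (simp add: powr_powr mult_ac)
  qed
  then have "\<forall>\<^sub>F \<kappa> in at_top. C \<le> box_const n * (\<epsilon> / 3 / ln \<kappa>) * (\<kappa> powr d) powr (p - 1)"
    by (simp add: filterlim_at_top)
  moreover have "\<forall>\<^sub>F \<kappa> in at_top. \<epsilon> / 3 / ln \<kappa> \<le> min 1 (r\<^sup>2)"
  proof -
    have "((\<lambda>\<kappa>::real. \<epsilon> / 3 / ln \<kappa>) \<longlongrightarrow> 0) at_top" by real_asymp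
    from order_tendstoD(2)[OF this, of "min 1 (r\<^sup>2)"] r0 show ?thesis
      by (auto elim!: eventually_mono)
  qed
  \<comment> \<open>Keeps \<open>4 * pi * t\<close> at most 1 up to the final time, so the Gaussian
    prefactor is at least 1 and may be dropped.\<close>
  moreover have "\<forall>\<^sub>F \<kappa> in at_top. 4 * pi * ((a + \<epsilon>) / ln \<kappa>) \<le> 1"
  proof -
    have "((\<lambda>\<kappa>::real. 4 * pi * ((a + \<epsilon>) / ln \<kappa>)) \<longlongrightarrow> 0) at_top" by real_asymp
    from order_tendstoD(2)[OF this, of 1] show ?thesis
      by (auto elim!: eventually_mono)
  qed
  moreover have "\<forall>\<^sub>F \<kappa>::real in at_top. 1 < \<kappa>" by (rule eventually_gt_at_top)
  ultimately show ?thesis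
  proof eventually_elim
    case (elim \<kappa>)
    define L where "L = ln \<kappa>"
    have L: "L > 0" using elim(4) by (simp add: L_def)
    define t0 where "t0 = (a + 2 * \<epsilon> / 3) / L"
    define H where "H = \<epsilon> / 3 / L"
    have t0: "t0 > 0" using a0 \<epsilon> L by (simp add: t0_def)
    have sum: "t0 + H = (a + \<epsilon>) / L"
      using L by (simp add: t0_def H_def field_simps)
    show ?case
    proof (intro allI impI, rule ccontr)
      fix T u assume sol: "is_solution n p (dirac_mass n \<kappa> z) T u"
        and "\<not> T \<le> ((snd z)\<^sup>2 / 4 + \<epsilon>) / ln \<kappa>"
      \<comment> \<open>The inequality is strict, so the final time \<open>t0 + H\<close> of the
        blow-up window still lies in the interval where the solution is defined.\<close>
      then have T: "t0 + H < T" by (simp add: sum a_def L_def)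
      have u0: "0 \<le> u x t" and eq: "ennreal (u x t) = ennreal (\<kappa> * Gker n x z t) + bpot n (\<lambda>y s. u (y, 0) s powr p) x t"
        if "x \<in> Dom n" "0 < t" "t < T" for x t
        using sol that elim(4) unfolding is_solution_dirac_iff[OF zD, of \<kappa>, OF less_imp_le[OF less_trans[OF zero_less_one elim(4)]]] by auto
      have "box_const n * H * (\<kappa> powr d) powr (p - 1) < 2 * 2 powr (1 / (p - 1))"
      proof (rule boundary_blow_up[where v = "\<lambda>y. u (y, 0)" and \<sigma> = t0 and a = "fst z" and r = r])
        fix y t assume y: "y \<in> cube n (fst z) r" and t: "t0 < t" "t \<le> t0 + H"
        have yD: "(y, 0) \<in> Dom n" using y cube_subset_space boundary_in_Dom by blast
        have t': "0 < t" "t < T" using t t0 T by auto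
        show "bpot n (\<lambda>y s. u (y, 0) s powr p) (y, 0) t \<le> ennreal (u (y, 0) t)"
          using eq[OF yD t'] by simp
        have "(y i - fst z i)\<^sup>2 \<le> r\<^sup>2" if "i < n" for i
        proof -
          have "y i \<in> {fst z i - r..fst z i + r}"
            by (rule PiE_mem[OF y[unfolded cube_def]]) (use that in simp)
          then have "\<bar>y i - fst z i\<bar> \<le> \<bar>r\<bar>"
            using r0 by auto
          then show ?thesis by (rule abs_le_square_iff[THEN iffD1])
        qed
        then have "(\<Sum>i<n. (y i - fst z i)\<^sup>2) \<le> (\<Sum>i<n. r\<^sup>2)" by (intro sum_mono) auto
        then have sq: "sqdist n (y, 0) z \<le> 4 * (a + \<epsilon> / 3)"
          using nr by (simp add: sqdist_def a_def)
        have "d * L - L = - ((a + \<epsilon> / 3) / t0)"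
        proof -
          define b where "b = a + 2 * \<epsilon> / 3"
          have "b > 0" using a0 \<epsilon> by (simp add: b_def)
          have d: "d = \<epsilon> / 3 / b" and t0': "t0 = b / L"
            unfolding d_def t0_def b_def by (rule refl)+
          have "d * L - L = (\<epsilon> / 3 - b) * L / b"
            using \<open>b > 0\<close> by (simp add: d field_simps)
          also have "\<epsilon> / 3 - b = - (a + \<epsilon> / 3)" by (simp add: b_def)
          finally show ?thesis by (simp only: t0' divide_divide_eq_right minus_divide_left mult_minus_left)
        qed
        also have "\<dots> \<le> - ((a + \<epsilon> / 3) / t)"
          using t t0 a0 \<epsilon> by (simp add: divide_left_mono)
        also have "\<dots> \<le> - sqdist n (y, 0) z / (4 * t)"
          using divide_right_mono[of "sqdist n (y, 0) z / 4" "a + \<epsilon> / 3" t] sq t' by simp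
        finally have e: "exp (d * L - L) \<le> exp (- sqdist n (y, 0) z / (4 * t))" by simp
        have "4 * pi * t \<le> 4 * pi * ((a + \<epsilon>) / L)"
          using t sum by (intro mult_left_mono) auto
        then have "4 * pi * t \<le> 1" using elim(3) by (simp add: L_def)
        then have "1 \<le> (4 * pi * t) powr (- (real n + 1) / 2)"
          using powr_mono2'[of "- (real n + 1) / 2" "4 * pi * t" 1] t' by simp
        then have "1 * exp (d * L - L) \<le> heat n (y, 0) z t"
          unfolding heat_def using e by (intro mult_mono) auto
        then have "exp (d * L - L) \<le> Gker n (y, 0) z t"
          using heat_nonneg[of n "(y, 0)" z t] unfolding Gker_boundary_left by linarith
        then have "\<kappa> * exp (d * L - L) \<le> \<kappa> * Gker n (y, 0) z t"
          by (rule mult_left_mono) (use elim(4) in simp)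
        moreover have "\<kappa> * exp (d * L - L) = \<kappa> powr d"
          using elim(4) by (simp add: exp_diff L_def powr_def)
        moreover have "ennreal (\<kappa> * Gker n (y, 0) z t) \<le> ennreal (u (y, 0) t)"
          using eq[OF yD t'] by simp
        then have "\<kappa> * Gker n (y, 0) z t \<le> u (y, 0) t"
          using u0[OF yD t'] by (simp add: ennreal_le_iff)
        ultimately show "\<kappa> powr d \<le> u (y, 0) t" by linarith
      next
        show "0 < H" using \<epsilon> L by (simp add: H_def)
        show "H \<le> 1" "H \<le> r\<^sup>2" using elim(2) by (simp_all add: H_def L_def)
        show "0 < \<kappa> powr d" using elim(4) by simp
        show "0 \<le> t0" using t0 by simp
      qed (rule p r0 z(1))+
      then show False using elim(1) by (simp add: C_def H_def L_def)
    qed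
  qed
qed

text \<open>Half of \<open>\<epsilon>\<close> absorbs the negative power of \<open>s\<close> in the
  kernel into the exponential. The other half leaves the boundary data below
  \<open>2 * \<kappa> powr (- \<epsilon> / (2 * (a - \<epsilon>)))\<close>, with
  \<open>a = (snd z)^2 / 4\<close>, and this tends to 0.\<close>

lemma eventually_minimal_solution:
  assumes p: "p > 1" and z: "fst z \<in> space (bmeas n)" "snd z > 0"
    and \<epsilon>: "\<epsilon> > 0" "\<epsilon> < (snd z)\<^sup>2 / 4"
  shows "\<forall>\<^sub>F \<kappa> in at_top. \<exists>u. is_minimal_solution n p (dirac_mass n \<kappa> z) (((snd z)\<^sup>2 / 4 - \<epsilon>) / ln \<kappa>) u"
proof -
  define a where "a = (snd z)\<^sup>2 / 4"
  define q where "q = (real n + 1) / 2"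
  have a\<epsilon>: "0 < a - \<epsilon>" using \<epsilon> by (simp add: a_def)
  have zD: "z \<in> Dom n" using z by (cases z) (simp add: Dom_def)
  have "((\<lambda>x::real. x powr q * exp (- (\<epsilon> / 2) * x)) \<longlongrightarrow> 0) at_top"
    using \<epsilon> by real_asymp
  \<comment> \<open>The variable \<open>x\<close> stands for \<open>1 / s\<close>: beyond
    \<open>V\<close>, the prefactor \<open>x powr q\<close> is below
    \<open>exp (\<epsilon> / 2 * x)\<close>.\<close>
  from order_tendstoD(2)[OF this, of 1] obtain V where V: "\<And>x. x \<ge> V \<Longrightarrow> x powr q * exp (- (\<epsilon> / 2) * x) < 1"
    by (auto simp: eventually_at_top_linorder)
  have "\<forall>\<^sub>F \<kappa> in at_top. V \<le> ln \<kappa> / (a - \<epsilon>)"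
  proof -
    have "filterlim (\<lambda>\<kappa>::real. ln \<kappa> / (a - \<epsilon>)) at_top at_top" using a\<epsilon> by real_asymp
    then show ?thesis by (simp add: filterlim_at_top)
  qed
  moreover have "\<forall>\<^sub>F \<kappa> in at_top. 4 * sqrt ((a - \<epsilon>) / ln \<kappa>) \<le> 1"
  proof -
    have "((\<lambda>\<kappa>::real. 4 * sqrt ((a - \<epsilon>) / ln \<kappa>)) \<longlongrightarrow> 0) at_top" using a\<epsilon> by real_asymp
    from order_tendstoD(2)[OF this, of 1] show ?thesis
      by (auto elim!: eventually_mono)
  qed
  moreover have "\<forall>\<^sub>F \<kappa> in at_top. 2 * exp (- (\<epsilon> / 2 / (a - \<epsilon>)) * ln \<kappa>) \<le> 1/2"
  proof -
    have "0 < \<epsilon> / 2 / (a - \<epsilon>)" using a\<epsilon> \<epsilon> by simp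
    then have "((\<lambda>\<kappa>::real. 2 * exp (- (\<epsilon> / 2 / (a - \<epsilon>)) * ln \<kappa>)) \<longlongrightarrow> 0) at_top" by real_asymp
    from order_tendstoD(2)[OF this, of "1/2"] show ?thesis
      by (auto elim!: eventually_mono)
  qed
  moreover have "\<forall>\<^sub>F \<kappa>::real in at_top. 1 < \<kappa>" by (rule eventually_gt_at_top)
  ultimately show ?thesis
  proof eventually_elim
    case (elim \<kappa>)
    define L where "L = ln \<kappa>"
    have L: "L > 0" using elim(4) by (simp add: L_def)
    have small: "\<kappa> * Gker n (y, 0) z s \<le> 1/2" if s: "0 < s" "s < (a - \<epsilon>) / L" for y s
    proof -
      have sq: "4 * a \<le> sqdist n (y, 0) z"
        by (simp add: sqdist_def a_def sum_nonneg)
      have inv: "L / (a - \<epsilon>) \<le> 1 / s" using s L a\<epsilon> by (simp add: field_simps)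
      then have "(1 / s) powr q * exp (- (\<epsilon> / 2) * (1 / s)) \<le> 1"
        using V[of "1 / s"] elim(1) by (simp add: L_def)
      then have 1: "(1 / s) powr q \<le> exp ((\<epsilon> / 2) * (1 / s))"
        by (simp add: exp_minus field_simps)
      have "(4 * pi * s) powr (- (real n + 1) / 2) \<le> s powr (- (real n + 1) / 2)"
        using s pi_gt3 by (intro powr_mono2') auto
      also have "\<dots> = (1 / s) powr q"
      proof -
        have "- (real n + 1) / 2 = - q" by (simp only: q_def minus_divide_left)
        then show ?thesis using s by (simp add: powr_minus powr_divide inverse_eq_divide)
      qed
      also note 1
      finally have 2: "(4 * pi * s) powr (- (real n + 1) / 2) \<le> exp ((\<epsilon> / 2) * (1 / s))" .
      have "- sqdist n (y, 0) z / (4 * s) \<le> - a * (1 / s)"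
        using sq s by (simp add: field_simps)
      then have "heat n (y, 0) z s \<le> exp ((\<epsilon> / 2) * (1 / s)) * exp (- a * (1 / s))"
        unfolding heat_def using 2 by (intro mult_mono) auto
      also have "\<dots> = exp (- ((a - \<epsilon> / 2) * (1 / s)))"
        by (simp add: exp_add[symmetric] algebra_simps)
      also have "\<dots> \<le> exp (- ((a - \<epsilon> / 2) * (L / (a - \<epsilon>))))"
        using inv a\<epsilon> \<epsilon> by (simp only: exp_le_cancel_iff neg_le_iff_le, intro mult_left_mono) auto
      \<comment> \<open>The quotient \<open>(a - \<epsilon> / 2) / (a - \<epsilon>)\<close> is 1
        plus a positive remainder; the 1 cancels the factor \<open>\<kappa>\<close> and the
        remainder gives the decay.\<close>
      also have "- ((a - \<epsilon> / 2) * (L / (a - \<epsilon>))) = - L + - (\<epsilon> / 2 / (a - \<epsilon>)) * L"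
        using a\<epsilon> by (simp add: field_simps)
      finally have "heat n (y, 0) z s \<le> exp (- L) * exp (- (\<epsilon> / 2 / (a - \<epsilon>)) * L)"
        by (simp only: exp_add)
      then have "\<kappa> * Gker n (y, 0) z s \<le> \<kappa> * (2 * (exp (- L) * exp (- (\<epsilon> / 2 / (a - \<epsilon>)) * L)))"
        unfolding Gker_boundary_left using elim(4) by (intro mult_left_mono) auto
      also have "\<dots> = 2 * exp (- (\<epsilon> / 2 / (a - \<epsilon>)) * L)"
        using elim(4) by (simp add: L_def exp_minus)
      finally show ?thesis using elim(3) by (simp add: L_def)
    qed
    show ?case
      using minimal_solution_exists[OF p zD, of \<kappa> "(a - \<epsilon>) / L"] small elim
      by (simp add: a_def L_def)
  qed
qed

theorem theorem6p3:
  fixes n :: nat and p :: real and z :: pt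
  assumes "p > 1"
    and "fst z \<in> space (bmeas n)" and "snd z > 0"
  shows "((\<lambda>\<kappa>. ereal (ln \<kappa>) * life_span n p (dirac_mass n \<kappa> z))
           \<longlongrightarrow> ereal ((snd z)^2 / 4)) at_top"
proof -
  define a where "a = (snd z)\<^sup>2 / 4"
  have a0: "a > 0" using assms by (simp add: a_def)
  let ?f = "\<lambda>\<kappa>. ereal (ln \<kappa>) * life_span n p (dirac_mass n \<kappa> z)"
  have upper: "\<forall>\<^sub>F \<kappa> in at_top. ?f \<kappa> \<le> ereal (a + \<epsilon>)" if "\<epsilon> > 0" for \<epsilon>
    using eventually_no_solution[OF assms that] eventually_gt_at_top[of 1]
  proof eventually_elim
    case (elim \<kappa>)
    have L: "ln \<kappa> > 0" using elim(2) by simp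
    have "T \<le> (a + \<epsilon>) / ln \<kappa>" if "is_solution n p (dirac_mass n \<kappa> z) T u" for T u
      using elim(1) that unfolding a_def by blast
    \<comment> \<open>The bound holds for all solutions, in particular for minimal ones; the extra
      element 0 in the supremum is covered because \<open>a + \<epsilon>\<close> is
      positive.\<close>
    then have "life_span n p (dirac_mass n \<kappa> z) \<le> ereal ((a + \<epsilon>) / ln \<kappa>)"
      unfolding life_span_def using L a0 that
      by (intro Sup_least) (auto simp: is_minimal_solution_def)
    then have "?f \<kappa> \<le> ereal (ln \<kappa>) * ereal ((a + \<epsilon>) / ln \<kappa>)"
      using L by (intro ereal_mult_left_mono) auto
    then show ?case using L by simp
  qed
  have lower: "\<forall>\<^sub>F \<kappa> in at_top. ereal (a - \<epsilon>) \<le> ?f \<kappa>" if "0 < \<epsilon>" "\<epsilon> < a" for \<epsilon>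
    using eventually_minimal_solution[OF assms that(1) that(2)[unfolded a_def]] eventually_gt_at_top[of 1]
  proof eventually_elim
    case (elim \<kappa>)
    have L: "ln \<kappa> > 0" using elim(2) by simp
    have "ereal ((a - \<epsilon>) / ln \<kappa>) \<le> life_span n p (dirac_mass n \<kappa> z)"
      unfolding life_span_def using elim(1) L that
      by (intro Sup_upper) (auto simp: a_def)
    then have "ereal (ln \<kappa>) * ereal ((a - \<epsilon>) / ln \<kappa>) \<le> ?f \<kappa>"
      using L by (intro ereal_mult_left_mono) auto
    then show ?case using L by simp
  qed
  have "(?f \<longlongrightarrow> ereal a) at_top"
  proof (rule order_tendstoI)
    fix y assume "y < ereal a"
    then obtain b where b: "y < ereal b" "b < a"
      using ereal_dense2 by (metis ereal_less(1) less_ereal.simps(1))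
    \<comment> \<open>The cap \<open>a / 2\<close> keeps the chosen \<open>\<epsilon>\<close> below
      \<open>a\<close> even when \<open>b\<close> is not positive.\<close>
    have "0 < min (a - b) (a / 2)" "min (a - b) (a / 2) < a" using b a0 by auto
    from lower[OF this] show "\<forall>\<^sub>F \<kappa> in at_top. y < ?f \<kappa>"
    proof eventually_elim
      case (elim \<kappa>)
      have "ereal b \<le> ereal (a - min (a - b) (a / 2))" by simp
      then show ?case using b(1) elim by (meson less_le_trans order_trans)
    qed
  next
    fix y assume "ereal a < y"
    then obtain b where b: "ereal b < y" "a < b"
      using ereal_dense2 by (metis less_ereal.simps(1))
    from upper[of "b - a"] b show "\<forall>\<^sub>F \<kappa> in at_top. ?f \<kappa> < y"
      by (auto elim!: eventually_mono intro: le_less_trans)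
  qed
  then show ?thesis by (simp add: a_def)
qed

end
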